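(* Let $\mathcal{M}=(M,g)$ be a pseudo-Riemannian manifold of dimension $m\ge3$ which is not homogeneous, which is homothety homogeneous, and which has $|R|^2\ne0$. For a homothety $\Phi$ of $\mathcal{M}$ let $\lambda(\Phi)>0$ be the constant such that $\Phi^*g=\lambda^2(\Phi)g$. Fix a base point $P_0$ of $M$ and define a smooth function $\mu\in C^\infty(M)$ by $$\mu(P):=\frac{|R|^2_{P_0}}{|R|^2_P}\,.$$ (1) If $\Phi_1$ and $\Phi_2$ are homotheties of $\mathcal{M}$, then $\lambda^2(\Phi_1\circ\Phi_2)=\lambda^2(\Phi_1)\cdot\lambda^2(\Phi_2)$. (2) For every homothety $\Phi$ of $\mathcal{M}$, $\lambda^2(\Phi)=\frac{\mu(\Phi(P))}{\mu(P)}$ for any $P\in M$. (3) $d\mu\ne0$ (at every point of $M$). (4) The level sets $M_c:=\{P\in M:\mu(P)=c\}$ define smooth submanifolds of $M$. Given any points $P_1,P_2\in M_c$, there exists an isometry $\Phi$ of $\mathcal{M}$ which preserves $M_c$ so that $\Phi(P_1)=P_2$. Thus $(M,g)$ has cohomogeneity one.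
   Context: $R$ is the $(0,4)$ curvature tensor of the Levi-Civita connection of $g$, and $|R|^2$ is its squared length with respect to $g$ (a smooth function on $M$, not necessarily positive in indefinite signature); $|R|^2_P$ is its value at $P$. An isometry of $\mathcal{M}$ is a diffeomorphism $T$ of $M$ with $T^*g=g$; a homothety of $\mathcal{M}$ is a diffeomorphism $T$ of $M$ such that $T^*g=\lambda^2g$ for some constant $0\ne\lambda\in\mathbb{R}$ (one may always take $\lambda>0$). $\mathcal{M}$ is homogeneous (respectively homothety homogeneous) if the group of isometries (respectively homotheties) acts transitively on $M$. $\mathcal{M}$ has cohomogeneity one if the group of isometries acts transitively on each member of a family of hypersurfaces which foliate $M$.
   Formalization: In (2), λ²(Φ) is corrected to λ⁴(Φ) = μ(Φ(P))/μ(P), since |R|² scales by λ⁻⁴ under g ↦ λ²g (on a cone over a round sphere, r ↦ sr gives ratio s⁴); M is taken connected, without which (3) fails for disjoint round spheres of radii 2^k. *)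

theory Defs
  imports "HOL-Analysis.Analysis"
begin

section \<open>Smooth functions on open subsets of a Euclidean space\<close>

fun Ck_on :: "nat \<Rightarrow> 'a::euclidean_space set \<Rightarrow> ('a \<Rightarrow> 'b::real_normed_vector) \<Rightarrow> bool" where
  "Ck_on 0 S f \<longleftrightarrow> continuous_on S f"
| "Ck_on (Suc k) S f \<longleftrightarrow>
     (\<forall>x\<in>S. f differentiable (at x)) \<and>
     (\<forall>v. Ck_on k S (\<lambda>x. frechet_derivative f (at x) v))"

text \<open>Only meaningful for open \<open>S\<close>: all derivatives are taken in the full space.\<close>

definition smooth_on :: "'a::euclidean_space set \<Rightarrow> ('a \<Rightarrow> 'b::real_normed_vector) \<Rightarrow> bool" where
  "smooth_on S f \<longleftrightarrow> (\<forall>k. Ck_on k S f)"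


section \<open>Smooth manifolds\<close>

text \<open>A chart is a pair of its domain and its coordinate map; the values of the coordinate map
  outside the domain are irrelevant. The dimension of the manifold is \<open>CARD('n)\<close>.\<close>

type_synonym ('a, 'n) chart = "'a set \<times> ('a \<Rightarrow> real ^ 'n)"

definition chart_on :: "'a topology \<Rightarrow> ('a, 'n::finite) chart \<Rightarrow> bool" where
  "chart_on X c \<longleftrightarrow> openin X (fst c) \<and> open (snd c ` fst c) \<and>
     homeomorphic_map (subtopology X (fst c)) (top_of_set (snd c ` fst c)) (snd c)"

definition chart_inv :: "('a, 'n::finite) chart \<Rightarrow> real ^ 'n \<Rightarrow> 'a" where
  "chart_inv c = inv_into (fst c) (snd c)"

text \<open>The map \<open>f\<close> read in the charts \<open>c\<close> (source) and \<open>d\<close> (target), and the open set of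
  coordinate points where this makes sense.\<close>

definition coord_rep ::
  "('a, 'n::finite) chart \<Rightarrow> ('a, 'n) chart \<Rightarrow> ('a \<Rightarrow> 'a) \<Rightarrow> real ^ 'n \<Rightarrow> real ^ 'n" where
  "coord_rep c d f = snd d \<circ> f \<circ> chart_inv c"

definition coord_dom :: "('a, 'n::finite) chart \<Rightarrow> ('a, 'n) chart \<Rightarrow> ('a \<Rightarrow> 'a) \<Rightarrow> (real ^ 'n) set" where
  "coord_dom c d f = snd c ` {p \<in> fst c. f p \<in> fst d}"

definition smoothly_compatible :: "('a, 'n::finite) chart \<Rightarrow> ('a, 'n) chart \<Rightarrow> bool" where
  "smoothly_compatible c d \<longleftrightarrow>
     smooth_on (coord_dom c d (\<lambda>p. p)) (coord_rep c d (\<lambda>p. p)) \<and>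
     smooth_on (coord_dom d c (\<lambda>p. p)) (coord_rep d c (\<lambda>p. p))"

definition maximal_smooth_atlas :: "'a topology \<Rightarrow> ('a, 'n::finite) chart set \<Rightarrow> bool" where
  "maximal_smooth_atlas X A \<longleftrightarrow>
     (\<forall>c\<in>A. chart_on X c) \<and>
     (\<Union>c\<in>A. fst c) = topspace X \<and>
     (\<forall>c\<in>A. \<forall>d\<in>A. smoothly_compatible c d) \<and>
     (\<forall>c. chart_on X c \<and> (\<forall>d\<in>A. smoothly_compatible c d) \<longrightarrow> c \<in> A)"

text \<open>Manifolds are connected. (Countably many disjoint round spheres of radii \<open>2 powi k\<close> form a
  disconnected homothety homogeneous, non-homogeneous space on which \<open>|R|\<^sup>2\<close> is locally constant.)\<close>

definition smooth_manifold :: "'a topology \<Rightarrow> ('a, 'n::finite) chart set \<Rightarrow> bool" where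
  "smooth_manifold X A \<longleftrightarrow>
     Hausdorff_space X \<and> second_countable X \<and> connected_space X \<and> maximal_smooth_atlas X A"

definition smooth_fun :: "('a, 'n::finite) chart set \<Rightarrow> ('a \<Rightarrow> real) \<Rightarrow> bool" where
  "smooth_fun A f \<longleftrightarrow> (\<forall>c\<in>A. smooth_on (snd c ` fst c) (f \<circ> chart_inv c))"

text \<open>\<open>coord_differential c f p\<close> is the differential of \<open>f\<close> at \<open>p\<close>, as a linear form on the
  tangent space identified with \<open>real ^ 'n\<close> by the chart \<open>c\<close>.\<close>

definition coord_differential ::
  "('a, 'n::finite) chart \<Rightarrow> ('a \<Rightarrow> real) \<Rightarrow> 'a \<Rightarrow> real ^ 'n \<Rightarrow> real" where
  "coord_differential c f p = frechet_derivative (f \<circ> chart_inv c) (at (snd c p))"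

definition smooth_map :: "'a topology \<Rightarrow> ('a, 'n::finite) chart set \<Rightarrow> ('a \<Rightarrow> 'a) \<Rightarrow> bool" where
  "smooth_map X A f \<longleftrightarrow> continuous_map X X f \<and>
     (\<forall>c\<in>A. \<forall>d\<in>A. smooth_on (coord_dom c d f) (coord_rep c d f))"

definition diffeomorphism :: "'a topology \<Rightarrow> ('a, 'n::finite) chart set \<Rightarrow> ('a \<Rightarrow> 'a) \<Rightarrow> bool" where
  "diffeomorphism X A f \<longleftrightarrow> bij_betw f (topspace X) (topspace X) \<and>
     smooth_map X A f \<and> smooth_map X A (inv_into (topspace X) f)"

definition embedded_submanifold ::
  "'a topology \<Rightarrow> ('a, 'n::finite) chart set \<Rightarrow> nat \<Rightarrow> 'a set \<Rightarrow> bool" where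
  "embedded_submanifold X A k S \<longleftrightarrow> S \<subseteq> topspace X \<and>
     (\<forall>p\<in>S. \<exists>c\<in>A. p \<in> fst c \<and>
        (\<exists>K::'n set. card K = k \<and>
           snd c ` (fst c \<inter> S) = {x \<in> snd c ` fst c. \<forall>i. i \<notin> K \<longrightarrow> x $ i = 0}))"

definition embedded_hypersurface ::
  "'a topology \<Rightarrow> ('a, 'n::finite) chart set \<Rightarrow> 'a set \<Rightarrow> bool" where
  "embedded_hypersurface X A S \<longleftrightarrow> embedded_submanifold X A (CARD('n) - 1) S"

text \<open>The members of the family are embedded, but need not be connected, so that they may meet the
  domain of a foliation chart in several (at most countably many) plaques.\<close>

definition foliated_by_hypersurfaces ::
  "'a topology \<Rightarrow> ('a, 'n::finite) chart set \<Rightarrow> 'a set set \<Rightarrow> bool" where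
  "foliated_by_hypersurfaces X A F \<longleftrightarrow>
     (\<forall>H\<in>F. H \<noteq> {} \<and> embedded_hypersurface X A H) \<and>
     disjoint F \<and> \<Union>F = topspace X \<and>
     (\<forall>p\<in>topspace X. \<exists>c\<in>A. p \<in> fst c \<and> (\<exists>a b. snd c ` fst c = box a b) \<and>
        (\<exists>i. \<forall>H\<in>F. \<exists>T. countable T \<and>
           snd c ` (fst c \<inter> H) = {x \<in> snd c ` fst c. x $ i \<in> T}))"


section \<open>Pseudo-Riemannian metrics, isometries and homotheties\<close>

text \<open>A \<open>(0,2)\<close> tensor field is given by its matrix of components in each chart, a function of
  the coordinates: \<open>g c x $ i $ j\<close> is the value of \<open>g\<close> on the \<open>i\<close>-th and \<open>j\<close>-th coordinate
  vector fields of \<open>c\<close> at the point with coordinates \<open>x\<close>.\<close>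

type_synonym ('a, 'n) tensor2 = "('a, 'n) chart \<Rightarrow> real ^ 'n \<Rightarrow> real ^ 'n ^ 'n"

text \<open>\<open>pulls_back_to A f g h\<close> states that the pull-back of \<open>g\<close> along \<open>f\<close> is \<open>h\<close>.\<close>

definition pulls_back_to :: "('a, 'n::finite) chart set \<Rightarrow> ('a \<Rightarrow> 'a) \<Rightarrow>
    ('a, 'n) tensor2 \<Rightarrow> ('a, 'n) tensor2 \<Rightarrow> bool" where
  "pulls_back_to A f g h \<longleftrightarrow>
     (\<forall>c\<in>A. \<forall>d\<in>A. \<forall>p\<in>fst c. f p \<in> fst d \<longrightarrow>
        (let J = jacobian (coord_rep c d f) (at (snd c p))
         in transpose J ** g d (snd d (f p)) ** J = h c (snd c p)))"

text \<open>The first condition is the transformation law of the components under changes of charts.\<close>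

definition pseudo_riemannian_metric :: "('a, 'n::finite) chart set \<Rightarrow> ('a, 'n) tensor2 \<Rightarrow> bool" where
  "pseudo_riemannian_metric A g \<longleftrightarrow>
     pulls_back_to A (\<lambda>p. p) g g \<and>
     (\<forall>c\<in>A. smooth_on (snd c ` fst c) (g c) \<and>
        (\<forall>x\<in>snd c ` fst c. transpose (g c x) = g c x \<and> invertible (g c x)))"

definition pseudo_riemannian_manifold ::
  "'a topology \<Rightarrow> ('a, 'n::finite) chart set \<Rightarrow> ('a, 'n) tensor2 \<Rightarrow> bool" where
  "pseudo_riemannian_manifold X A g \<longleftrightarrow> smooth_manifold X A \<and> pseudo_riemannian_metric A g"

definition scale_metric :: "real \<Rightarrow> ('a, 'n::finite) tensor2 \<Rightarrow> ('a, 'n) tensor2" where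
  "scale_metric r g = (\<lambda>c x. r *\<^sub>R g c x)"

definition isometry ::
  "'a topology \<Rightarrow> ('a, 'n::finite) chart set \<Rightarrow> ('a, 'n) tensor2 \<Rightarrow> ('a \<Rightarrow> 'a) \<Rightarrow> bool" where
  "isometry X A g f \<longleftrightarrow> diffeomorphism X A f \<and> pulls_back_to A f g g"

definition homothety ::
  "'a topology \<Rightarrow> ('a, 'n::finite) chart set \<Rightarrow> ('a, 'n) tensor2 \<Rightarrow> ('a \<Rightarrow> 'a) \<Rightarrow> bool" where
  "homothety X A g f \<longleftrightarrow> diffeomorphism X A f \<and>
     (\<exists>l. l \<noteq> 0 \<and> pulls_back_to A f g (scale_metric (l\<^sup>2) g))"

definition homothety_factor ::
  "('a, 'n::finite) chart set \<Rightarrow> ('a, 'n) tensor2 \<Rightarrow> ('a \<Rightarrow> 'a) \<Rightarrow> real" where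
  "homothety_factor A g f = (THE l. l > 0 \<and> pulls_back_to A f g (scale_metric (l\<^sup>2) g))"

definition homogeneous ::
  "'a topology \<Rightarrow> ('a, 'n::finite) chart set \<Rightarrow> ('a, 'n) tensor2 \<Rightarrow> bool" where
  "homogeneous X A g \<longleftrightarrow>
     (\<forall>p\<in>topspace X. \<forall>q\<in>topspace X. \<exists>f. isometry X A g f \<and> f p = q)"

definition homothety_homogeneous ::
  "'a topology \<Rightarrow> ('a, 'n::finite) chart set \<Rightarrow> ('a, 'n) tensor2 \<Rightarrow> bool" where
  "homothety_homogeneous X A g \<longleftrightarrow>
     (\<forall>p\<in>topspace X. \<forall>q\<in>topspace X. \<exists>f. homothety X A g f \<and> f p = q)"

definition cohomogeneity_one ::
  "'a topology \<Rightarrow> ('a, 'n::finite) chart set \<Rightarrow> ('a, 'n) tensor2 \<Rightarrow> bool" where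
  "cohomogeneity_one X A g \<longleftrightarrow>
     (\<exists>F. foliated_by_hypersurfaces X A F \<and>
        (\<forall>H\<in>F. (\<forall>f. isometry X A g f \<longrightarrow> f ` H = H) \<and>
           (\<forall>p\<in>H. \<forall>q\<in>H. \<exists>f. isometry X A g f \<and> f p = q)))"


section \<open>Curvature\<close>

text \<open>Throughout, \<open>G\<close> is the matrix of components of a metric in one chart.\<close>

definition partial :: "'n::finite \<Rightarrow> (real ^ 'n \<Rightarrow> real) \<Rightarrow> real ^ 'n \<Rightarrow> real" where
  "partial i f x = frechet_derivative f (at x) (axis i 1)"

text \<open>The connection coefficients of the Levi-Civita connection,
  \<open>\<nabla>\<^sub>i \<partial>\<^sub>j = (\<Sum>k. christoffel G x k i j \<partial>\<^sub>k)\<close>; \<open>levi_civita_iff\<close> below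
  shows that they are the only ones which are torsion free and for which \<open>G\<close> is parallel.\<close>

definition christoffel ::
  "(real ^ 'n \<Rightarrow> real ^ 'n ^ 'n) \<Rightarrow> real ^ 'n \<Rightarrow> 'n::finite \<Rightarrow> 'n \<Rightarrow> 'n \<Rightarrow> real" where
  "christoffel G x k i j = (1 / 2) * (\<Sum>l\<in>UNIV. matrix_inv (G x) $ k $ l *
     (partial i (\<lambda>y. G y $ j $ l) x + partial j (\<lambda>y. G y $ i $ l) x
        - partial l (\<lambda>y. G y $ i $ j) x))"

text \<open>\<open>R(\<partial>\<^sub>i, \<partial>\<^sub>j) \<partial>\<^sub>k = \<nabla>\<^sub>i \<nabla>\<^sub>j \<partial>\<^sub>k - \<nabla>\<^sub>j \<nabla>\<^sub>i \<partial>\<^sub>k\<close>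
  has the \<open>l\<close>-th component \<open>curvature13 G x i j k l\<close>, and
  \<open>curvature04 G x i j k l = g(R(\<partial>\<^sub>i, \<partial>\<^sub>j) \<partial>\<^sub>k, \<partial>\<^sub>l)\<close>.\<close>

definition curvature13 ::
  "(real ^ 'n \<Rightarrow> real ^ 'n ^ 'n) \<Rightarrow> real ^ 'n \<Rightarrow> 'n::finite \<Rightarrow> 'n \<Rightarrow> 'n \<Rightarrow> 'n \<Rightarrow> real" where
  "curvature13 G x i j k l =
     partial i (\<lambda>y. christoffel G y l j k) x - partial j (\<lambda>y. christoffel G y l i k) x
     + (\<Sum>m\<in>UNIV. christoffel G x m j k * christoffel G x l i m
                 - christoffel G x m i k * christoffel G x l j m)"

definition curvature04 ::
  "(real ^ 'n \<Rightarrow> real ^ 'n ^ 'n) \<Rightarrow> real ^ 'n \<Rightarrow> 'n::finite \<Rightarrow> 'n \<Rightarrow> 'n \<Rightarrow> 'n \<Rightarrow> real" where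
  "curvature04 G x i j k l = (\<Sum>m\<in>UNIV. G x $ l $ m * curvature13 G x i j k m)"

text \<open>\<open>|R|\<^sup>2\<close>, the full contraction of the \<open>(0,4)\<close> curvature tensor with itself.\<close>

definition local_curvature_norm_sq ::
  "(real ^ 'n \<Rightarrow> real ^ 'n ^ 'n) \<Rightarrow> real ^ 'n::finite \<Rightarrow> real" where
  "local_curvature_norm_sq G x =
     (\<Sum>i\<in>UNIV. \<Sum>j\<in>UNIV. \<Sum>k\<in>UNIV. \<Sum>l\<in>UNIV. \<Sum>a\<in>UNIV. \<Sum>b\<in>UNIV. \<Sum>c\<in>UNIV. \<Sum>d\<in>UNIV.
        matrix_inv (G x) $ i $ a * matrix_inv (G x) $ j $ b *
        matrix_inv (G x) $ k $ c * matrix_inv (G x) $ l $ d *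
        curvature04 G x i j k l * curvature04 G x a b c d)"

text \<open>The value at \<open>p\<close> does not depend on the chart around \<open>p\<close>.\<close>

definition curvature_norm_sq ::
  "('a, 'n::finite) chart set \<Rightarrow> ('a, 'n) tensor2 \<Rightarrow> 'a \<Rightarrow> real" where
  "curvature_norm_sq A g p =
     (let c = (SOME c. c \<in> A \<and> p \<in> fst c) in local_curvature_norm_sq (g c) (snd c p))"


subsection \<open>The Levi-Civita connection and rescaling of the metric\<close>

lemma matrix_inv_sum:
  fixes M :: "real ^ 'n ^ 'n"
  assumes "invertible M"
  shows "(\<Sum>l\<in>UNIV. M $ i $ l * matrix_inv M $ l $ j) = (if i = j then 1 else 0)"
    and "(\<Sum>l\<in>UNIV. matrix_inv M $ i $ l * M $ l $ j) = (if i = j then 1 else 0)"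
proof -
  have "M ** matrix_inv M = mat 1 \<and> matrix_inv M ** M = mat 1"
    using assms unfolding invertible_def matrix_inv_def by (rule someI_ex)
  then have "(M ** matrix_inv M) $ i $ j = mat 1 $ i $ j"
    and "(matrix_inv M ** M) $ i $ j = mat 1 $ i $ j" by auto
  then show "(\<Sum>l\<in>UNIV. M $ i $ l * matrix_inv M $ l $ j) = (if i = j then 1 else 0)"
    and "(\<Sum>l\<in>UNIV. matrix_inv M $ i $ l * M $ l $ j) = (if i = j then 1 else 0)"
    by (simp_all add: matrix_matrix_mult_def mat_def)
qed

lemma partial_cong:
  assumes "open S" "x \<in> S" "\<And>y. y \<in> S \<Longrightarrow> f y = h y"
  shows "partial i f x = partial i h x"
proof -
  have "(f has_derivative D) (at x) \<longleftrightarrow> (h has_derivative D) (at x)" for D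
    using assms by (metis has_derivative_transform_within_open)
  then show ?thesis unfolding partial_def frechet_derivative_def by presburger
qed

lemma levi_civita_iff:
  fixes G :: "real ^ 'n \<Rightarrow> real ^ 'n ^ 'n" and \<Gamma> :: "'n::finite \<Rightarrow> 'n \<Rightarrow> 'n \<Rightarrow> real"
  assumes S: "open S" "x \<in> S" and sym: "\<And>y. y \<in> S \<Longrightarrow> transpose (G y) = G y"
    and inv: "invertible (G x)"
  shows "((\<forall>k i j. \<Gamma> k i j = \<Gamma> k j i) \<and>
          (\<forall>k i j. partial k (\<lambda>y. G y $ i $ j) x =
             (\<Sum>l\<in>UNIV. \<Gamma> l k i * G x $ l $ j + \<Gamma> l k j * G x $ i $ l)))
        \<longleftrightarrow> \<Gamma> = christoffel G x"
proof -
  define D where "D k i j = partial k (\<lambda>y. G y $ i $ j) x" for k i j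
  define L where "L \<Gamma> m i j = (\<Sum>l\<in>UNIV. G x $ m $ l * \<Gamma> l i j)" for m i j and \<Gamma> :: "'n \<Rightarrow> 'n \<Rightarrow> 'n \<Rightarrow> real"
  have Gs: "G y $ i $ j = G y $ j $ i" if "y \<in> S" for y i j
    using sym[OF that] by (metis transpose_def vec_lambda_beta)
  have Ds: "D k i j = D k j i" for k i j
    unfolding D_def using S Gs by (intro partial_cong)
  have delta: "(\<Sum>q\<in>UNIV. (if m = q then 1 else 0) * f q) = f m" for m and f :: "'n \<Rightarrow> real"
    by (simp add: if_distrib[of "\<lambda>t. t * _"] cong: if_cong)
  have lower: "L (christoffel G x) m i j = (D i j m + D j i m - D m i j) / 2" for m i j
  proof -
    have "L (christoffel G x) m i j = (\<Sum>l\<in>UNIV. \<Sum>q\<in>UNIV.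
        G x $ m $ l * matrix_inv (G x) $ l $ q * ((D i j q + D j i q - D q i j) / 2))"
      unfolding L_def christoffel_def D_def sum_distrib_left
      by (intro sum.cong refl) (simp add: field_simps)
    also have "\<dots> = (\<Sum>q\<in>UNIV. (\<Sum>l\<in>UNIV. G x $ m $ l * matrix_inv (G x) $ l $ q)
        * ((D i j q + D j i q - D q i j) / 2))"
      by (subst sum.swap) (simp only: sum_distrib_right)
    also have "\<dots> = (D i j m + D j i m - D m i j) / 2"
      unfolding matrix_inv_sum(1)[OF inv] by (rule delta)
    finally show ?thesis .
  qed
  have raise: "\<Gamma> k i j = (\<Sum>m\<in>UNIV. matrix_inv (G x) $ k $ m * L \<Gamma> m i j)"
    for k i j and \<Gamma> :: "'n \<Rightarrow> 'n \<Rightarrow> 'n \<Rightarrow> real"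
  proof -
    have "(\<Sum>m\<in>UNIV. matrix_inv (G x) $ k $ m * L \<Gamma> m i j) =
      (\<Sum>l\<in>UNIV. (\<Sum>m\<in>UNIV. matrix_inv (G x) $ k $ m * G x $ m $ l) * \<Gamma> l i j)"
      unfolding L_def sum_distrib_left sum_distrib_right
      by (subst sum.swap) (simp add: mult.assoc)
    also have "\<dots> = \<Gamma> k i j"
      unfolding matrix_inv_sum(2)[OF inv] by (rule delta)
    finally show ?thesis by simp
  qed
  have par: "(\<Sum>l\<in>UNIV. \<Gamma> l k i * G x $ l $ j + \<Gamma> l k j * G x $ i $ l) = L \<Gamma> j k i + L \<Gamma> i k j"
    for k i j and \<Gamma> :: "'n \<Rightarrow> 'n \<Rightarrow> 'n \<Rightarrow> real"
    unfolding L_def sum.distrib[symmetric]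
    by (intro sum.cong refl) (simp add: Gs[OF S(2), of _ j] mult.commute)
  show ?thesis
  proof (intro iffI conjI allI)
    assume a: "(\<forall>k i j. \<Gamma> k i j = \<Gamma> k j i) \<and>
          (\<forall>k i j. partial k (\<lambda>y. G y $ i $ j) x =
             (\<Sum>l\<in>UNIV. \<Gamma> l k i * G x $ l $ j + \<Gamma> l k j * G x $ i $ l))"
    have D: "D k i j = L \<Gamma> j k i + L \<Gamma> i k j" for k i j
      using a par unfolding D_def by metis
    have Ls: "L \<Gamma> m i j = L \<Gamma> m j i" for m i j
      unfolding L_def using a by metis
    have "L \<Gamma> m i j = L (christoffel G x) m i j" for m i j
      unfolding lower D using Ls[of m i j] Ls[of i m j] Ls[of j m i] by simp
    then show "\<Gamma> = christoffel G x"
      by (intro ext) (simp only: raise[of \<Gamma>] raise[of "christoffel G x"])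
  next
    assume c: "\<Gamma> = christoffel G x"
    show "\<Gamma> k i j = \<Gamma> k j i" for k i j
    proof -
      have "L \<Gamma> m i j = L \<Gamma> m j i" for m
        unfolding c lower using Ds[of m i j] by simp
      then show ?thesis
        unfolding raise[of \<Gamma> k i j] raise[of \<Gamma> k j i] by simp
    qed
    show "partial k (\<lambda>y. G y $ i $ j) x =
        (\<Sum>l\<in>UNIV. \<Gamma> l k i * G x $ l $ j + \<Gamma> l k j * G x $ i $ l)" for k i j
      unfolding par unfolding c lower D_def[symmetric] using Ds[of k i j] Ds[of i k j] Ds[of j k i]
      by (simp add: field_simps)
  qed
qed

lemma matrix_inv_scaleR:
  fixes M :: "real ^ 'n ^ 'n"
  assumes "invertible M" "r \<noteq> 0"
  shows "matrix_inv (r *\<^sub>R M) = (1 / r) *\<^sub>R matrix_inv M"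
proof -
  have unique: "matrix_inv P = Q" if "P ** Q = mat 1" "Q ** P = mat 1" for P Q :: "real ^ 'n ^ 'n"
  proof -
    have "P ** matrix_inv P = mat 1 \<and> matrix_inv P ** P = mat 1"
      unfolding matrix_inv_def by (rule someI[of _ Q]) (use that in simp)
    then show ?thesis using that by (metis matrix_mul_assoc matrix_mul_lid matrix_mul_rid)
  qed
  have "M ** matrix_inv M = mat 1 \<and> matrix_inv M ** M = mat 1"
    using assms(1) unfolding invertible_def matrix_inv_def by (rule someI_ex)
  then have "(r *\<^sub>R M) ** ((1 / r) *\<^sub>R matrix_inv M) = mat 1"
    and "((1 / r) *\<^sub>R matrix_inv M) ** (r *\<^sub>R M) = mat 1"
    using assms(2) by (simp_all add: matrix_scalar_ac flip: scalar_matrix_assoc)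
  then show ?thesis by (rule unique)
qed

text \<open>A metric multiplied by \<open>r = \<lambda>\<^sup>2\<close> has \<open>|R|\<^sup>2\<close> multiplied by
  \<open>1 / r\<^sup>2 = \<lambda> powi (-4)\<close>. Hence a quotient of two values of \<open>|R|\<^sup>2\<close> is related by a
  homothety to the fourth power of its factor, not to the square.\<close>

lemma local_curvature_norm_sq_scaleR:
  fixes G :: "real ^ 'n::finite \<Rightarrow> real ^ 'n ^ 'n"
  assumes S: "open S" "x \<in> S" and inv: "\<And>y. y \<in> S \<Longrightarrow> invertible (G y)"
    and diff: "\<And>y. y \<in> S \<Longrightarrow> G differentiable (at y)" and r: "r \<noteq> 0"
  shows "local_curvature_norm_sq (\<lambda>y. r *\<^sub>R G y) x = local_curvature_norm_sq G x / r\<^sup>2"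
proof -
  have p: "partial i (\<lambda>y. r * G y $ j $ k) x = r * partial i (\<lambda>y. G y $ j $ k) x" if "x \<in> S" for x i j k
  proof -
    have "(\<lambda>y. G y $ j $ k) differentiable (at x)"
      using diff[OF that, THEN frechet_derivative_works[THEN iffD1]]
      by (intro differentiableI) (rule bounded_linear.has_derivative[OF bounded_linear_vec_nth])+
    then have "((\<lambda>y. r * G y $ j $ k) has_derivative
        (\<lambda>v. r * frechet_derivative (\<lambda>y. G y $ j $ k) (at x) v)) (at x)"
      by (intro has_derivative_mult_right) (simp flip: frechet_derivative_works)
    from frechet_derivative_at[OF this, symmetric] show ?thesis by (simp add: partial_def)
  qed
  have chr: "christoffel (\<lambda>y. r *\<^sub>R G y) y k i j = christoffel G y k i j" if "y \<in> S" for y k i j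
  proof -
    have "(1 / r * m) * (r * t + r * u - r * v) = m * (t + u - v)" for m t u v :: real
      using r by (simp add: field_simps)
    then show ?thesis
      unfolding christoffel_def matrix_inv_scaleR[OF inv[OF that] r] vector_scaleR_component
        real_scaleR_def p[OF that] by simp
  qed
  have c13: "curvature13 (\<lambda>y. r *\<^sub>R G y) x i j k l = curvature13 G x i j k l" for i j k l
  proof -
    have "partial i (\<lambda>y. christoffel (\<lambda>y. r *\<^sub>R G y) y l j k) x
        = partial i (\<lambda>y. christoffel G y l j k) x" for i j
      by (rule partial_cong[OF S]) (rule chr)
    then show ?thesis
      unfolding curvature13_def chr[OF S(2)] by simp
  qed
  have c04: "curvature04 (\<lambda>y. r *\<^sub>R G y) x i j k l = r * curvature04 G x i j k l" for i j k l
    unfolding curvature04_def c13 by (simp add: sum_distrib_left mult.assoc)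
  have "(1 / r * m) * (1 / r * n) * (1 / r * w) * (1 / r * q) * (r * t) * (r * u)
      = m * n * w * q * t * u / r\<^sup>2" for m n w q t u :: real
    using r by (simp add: power2_eq_square)
  then show ?thesis
    unfolding local_curvature_norm_sq_def c04 matrix_inv_scaleR[OF inv[OF S(2)] r]
      vector_scaleR_component real_scaleR_def sum_divide_distrib by simp
qed

end

theory Submission
  imports Defs
begin

text \<open>Since \<open>|R|\<^sup>2\<close> is natural under pull-back and is multiplied by \<open>\<lambda> powi (-4)\<close> when the metric is
  multiplied by \<open>\<lambda>\<^sup>2\<close>, a homothety \<open>\<Phi>\<close> satisfies \<open>\<mu> \<circ> \<Phi> = \<lambda>(\<Phi>)^4 \<mu>\<close>. By transitivity of the homotheties, a single critical
  point of \<open>\<mu>\<close> would make every point critical and \<open>\<mu>\<close> constant; then all homotheties would be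
  isometries and the manifold homogeneous. So \<open>\<mu>\<close> has no critical points and its level sets are the
  leaves of a foliation. A homothety joining two points of one level set has factor \<open>1\<close>.\<close>

section \<open>Linear algebra\<close>

text \<open>The weight of the proof lies in naturality, because curvature is given by component
  formulas in single charts. A homothety read in two charts is a map \<phi> that pulls a metric H
  back to r G with r = \<lambda>^2. Christoffel symbols are not tensorial: they pick up second
  derivatives of \<phi>. Their transformation law is not computed but read off from the uniqueness
  in \<open>levi_civita_iff\<close>. Differentiating it once more, the extra terms are either
  opposite or symmetric in the two antisymmetrized slots, and R is free of them. For the identity
  and r = 1 the same statement shows that \<open>curvature_norm_sq\<close> does not depend on the
  chosen chart, whence smoothness of \<mu>. The exponent 4 is a count: four inverse metrics give
  r^-4, two copies of the (0,4) tensor give r^2, and r^-2 = \<lambda>^-4. Since \<mu> is nonzero,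
  \<mu>(p) = \<lambda>^4 \<mu>(p) can be solved for \<lambda> = 1 whatever the sign of |R|^2.
  Finally, charts adapted to \<mu> must lie in the maximal smooth atlas, so the inverse function in
  the straightening has to be smooth of every order.\<close>

lemma vec_expand_axis: "(\<Sum>i\<in>UNIV. (v $ i) *\<^sub>R axis i (1::real)) = (v :: real ^ 'n)"
  using basis_expansion[of v] by (simp add: scalar_mult_eq_scaleR)

lemma linear_expand_axis:
  fixes f :: "real ^ 'n \<Rightarrow> 'b::real_vector"
  assumes "linear f"
  shows "f v = (\<Sum>i\<in>UNIV. (v $ i) *\<^sub>R f (axis i 1))"
proof -
  have "f (\<Sum>i\<in>UNIV. (v $ i) *\<^sub>R axis i 1) = (\<Sum>i\<in>UNIV. (v $ i) *\<^sub>R f (axis i 1))"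
    by (simp add: linear_sum[OF assms] linear_scale[OF assms])
  then show ?thesis unfolding vec_expand_axis .
qed

lemma linear_eq_on_axis:
  fixes f h :: "real ^ 'n \<Rightarrow> 'b::real_vector"
  assumes "linear f" "linear h" "\<And>i. f (axis i 1) = h (axis i 1)"
  shows "f v = h v"
  unfolding linear_expand_axis[OF assms(1), of v] linear_expand_axis[OF assms(2), of v] assms(3) ..

lemma matrix_inv_mult:
  fixes M :: "real ^ 'n ^ 'n"
  assumes "invertible M"
  shows "M ** matrix_inv M = mat 1" "matrix_inv M ** M = mat 1"
proof -
  have "M ** matrix_inv M = mat 1 \<and> matrix_inv M ** M = mat 1"
    using assms unfolding invertible_def matrix_inv_def by (rule someI_ex)
  then show "M ** matrix_inv M = mat 1" "matrix_inv M ** M = mat 1" by auto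
qed

section \<open>Calculus of smooth functions\<close>

lemma Ck_on_subset: "Ck_on k S f \<Longrightarrow> T \<subseteq> S \<Longrightarrow> Ck_on k T f"
  by (induction k arbitrary: f) (auto intro: continuous_on_subset)

text \<open>No differentiability is assumed: \<open>frechet_derivative\<close> chooses from the set
  of derivatives, and the two functions have the same set.\<close>

lemma frechet_derivative_cong_open:
  assumes "open S" "x \<in> S" "\<And>y. y \<in> S \<Longrightarrow> f y = h y"
  shows "frechet_derivative f (at x) = frechet_derivative h (at x)"
proof -
  have "(f has_derivative D) (at x) \<longleftrightarrow> (h has_derivative D) (at x)" for D
    using assms by (metis has_derivative_transform_within_open)
  then show ?thesis unfolding frechet_derivative_def by presburger
qed

lemma differentiable_cong_open:
  assumes "open S" "x \<in> S" "\<And>y. y \<in> S \<Longrightarrow> f y = h y"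
  shows "f differentiable (at x) \<longleftrightarrow> h differentiable (at x)"
proof -
  have "(f has_derivative D) (at x) \<longleftrightarrow> (h has_derivative D) (at x)" for D
    using assms by (metis has_derivative_transform_within_open)
  then show ?thesis unfolding differentiable_def by presburger
qed

lemma Ck_on_cong:
  assumes "open S" "\<And>y. y \<in> S \<Longrightarrow> f y = h y"
  shows "Ck_on k S f \<longleftrightarrow> Ck_on k S h"
  using assms(2)
proof (induction k arbitrary: f h)
  case 0
  then show ?case by (simp cong: continuous_on_cong)
next
  case (Suc k)
  have "f differentiable (at x) \<longleftrightarrow> h differentiable (at x)" if "x \<in> S" for x
    using differentiable_cong_open[OF assms(1) that Suc.prems] .
  moreover have "Ck_on k S (\<lambda>x. frechet_derivative f (at x) v) \<longleftrightarrow>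
      Ck_on k S (\<lambda>x. frechet_derivative h (at x) v)" for v
    using frechet_derivative_cong_open[OF assms(1) _ Suc.prems] by (intro Suc.IH) auto
  ultimately show ?case by auto
qed

text \<open>The definition speaks of the chosen \<open>frechet_derivative\<close>. This rule accepts
  any formula for the derivative instead, and so carries the induction step of the differentiation
  rules below.\<close>

lemma Ck_on_SucI:
  assumes "open S" "\<And>x. x \<in> S \<Longrightarrow> (f has_derivative f' x) (at x)" "\<And>v. Ck_on k S (\<lambda>x. f' x v)"
  shows "Ck_on (Suc k) S f"
proof -
  have "frechet_derivative f (at x) = f' x" if "x \<in> S" for x
    using frechet_derivative_at[OF assms(2)[OF that]] by simp
  then have "Ck_on k S (\<lambda>x. frechet_derivative f (at x) v)" for v
    using Ck_on_cong[OF assms(1), of "\<lambda>x. frechet_derivative f (at x) v" "\<lambda>x. f' x v"] assms(3) by simp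
  then show ?thesis using assms(2) by (auto intro: differentiableI)
qed

lemma Ck_on_has_derivative:
  assumes "Ck_on (Suc k) S f" "x \<in> S"
  shows "(f has_derivative frechet_derivative f (at x)) (at x)"
  using assms by (simp flip: frechet_derivative_works)

text \<open>The clause for \<open>Suc k\<close> does not contain the one for \<open>k\<close>, so
  lowering the order needs an induction of its own, which starts from the continuity of
  differentiable functions.\<close>

lemma Ck_on_SucD: "Ck_on (Suc k) S f \<Longrightarrow> Ck_on k S f"
proof (induction k arbitrary: f)
  case 0
  then show ?case
    by (auto intro!: continuous_at_imp_continuous_on differentiable_imp_continuous_within)
next
  case (Suc k)
  from Suc.prems have "\<And>v. Ck_on (Suc k) S (\<lambda>x. frechet_derivative f (at x) v)"
    unfolding Ck_on.simps(2)[of "Suc k"] by blast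
  then have "\<And>v. Ck_on k S (\<lambda>x. frechet_derivative f (at x) v)" by (rule Suc.IH)
  then show ?case using Suc.prems unfolding Ck_on.simps(2)[of k] Ck_on.simps(2)[of "Suc k"] by blast
qed

lemma Ck_on_const: "Ck_on k S (\<lambda>x. c)"
  by (induction k arbitrary: c) auto

lemma Ck_on_bounded_linear:
  assumes L: "bounded_linear L" and "open S" "Ck_on k S f"
  shows "Ck_on k S (\<lambda>x. L (f x))"
  using assms(3)
proof (induction k arbitrary: f)
  case 0
  then show ?case by (simp add: bounded_linear.continuous_on[OF L])
next
  case (Suc k)
  show ?case
  proof (rule Ck_on_SucI[OF assms(2)])
    show "((\<lambda>x. L (f x)) has_derivative (\<lambda>v. L (frechet_derivative f (at x) v))) (at x)" if "x \<in> S" for x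
      by (rule bounded_linear.has_derivative[OF L Ck_on_has_derivative[OF Suc.prems that]])
    show "Ck_on k S (\<lambda>x. L (frechet_derivative f (at x) v))" for v
      using Suc by auto
  qed
qed

lemma Ck_on_id: "open S \<Longrightarrow> Ck_on k S (\<lambda>x. x)"
  using Ck_on_SucI[of S "\<lambda>x. x" "\<lambda>x v. v"] Ck_on_const[of _ S] has_derivative_ident
  by (metis Ck_on_SucD)

lemma Ck_on_add:
  assumes "open S" "Ck_on k S f" "Ck_on k S h"
  shows "Ck_on k S (\<lambda>x. f x + h x)"
  using assms(2,3)
proof (induction k arbitrary: f h)
  case (Suc k)
  show ?case
  proof (rule Ck_on_SucI[OF assms(1)])
    show "((\<lambda>x. f x + h x) has_derivative
        (\<lambda>v. frechet_derivative f (at x) v + frechet_derivative h (at x) v)) (at x)" if "x \<in> S" for x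
      by (rule has_derivative_add[OF Suc.prems[THEN Ck_on_has_derivative, OF that]])
    show "Ck_on k S (\<lambda>x. frechet_derivative f (at x) v + frechet_derivative h (at x) v)" for v
      using Suc by auto
  qed
qed (auto intro: continuous_on_add)

text \<open>By the product rule each summand of the derivative pairs one factor with the derivative
  of the other. The induction therefore runs over all f and h, and the undifferentiated factor is
  lowered by \<open>Ck_on_SucD\<close>. Products, scalar multiples and matrix-vector products are
  instances.\<close>

lemma Ck_on_bilinear:
  assumes B: "bounded_bilinear B" and "open S" "Ck_on k S f" "Ck_on k S h"
  shows "Ck_on k S (\<lambda>x. B (f x) (h x))"
  using assms(3,4)
proof (induction k arbitrary: f h)
  case 0
  then show ?case by (simp add: bounded_bilinear.continuous_on[OF B])
next
  case (Suc k)
  show ?case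
  proof (rule Ck_on_SucI[OF assms(2)])
    show "((\<lambda>x. B (f x) (h x)) has_derivative
        (\<lambda>v. B (f x) (frechet_derivative h (at x) v) + B (frechet_derivative f (at x) v) (h x))) (at x)"
      if "x \<in> S" for x
      by (rule bounded_bilinear.FDERIV[OF B Suc.prems[THEN Ck_on_has_derivative, OF that]])
    show "Ck_on k S (\<lambda>x. B (f x) (frechet_derivative h (at x) v) + B (frechet_derivative f (at x) v) (h x))" for v
      using Suc.prems Ck_on_SucD[OF Suc.prems(1)] Ck_on_SucD[OF Suc.prems(2)]
      by (intro Ck_on_add[OF assms(2)] Suc.IH) auto
  qed
qed

lemmas Ck_on_mult = Ck_on_bilinear[OF bounded_bilinear_mult]
lemmas Ck_on_scaleR = Ck_on_bilinear[OF bounded_bilinear_scaleR]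

lemma Ck_on_minus: "open S \<Longrightarrow> Ck_on k S f \<Longrightarrow> Ck_on k S (\<lambda>x. - f x)"
  by (rule Ck_on_bounded_linear[OF bounded_linear_minus[OF bounded_linear_ident]])

lemma Ck_on_diff:
  "open S \<Longrightarrow> Ck_on k S f \<Longrightarrow> Ck_on k S h \<Longrightarrow> Ck_on k S (\<lambda>x. f x - h x)"
  using Ck_on_add[of S k f "\<lambda>x. - h x"] Ck_on_minus[of S k h] by simp

lemma Ck_on_sum:
  assumes "open S" "\<And>i. i \<in> I \<Longrightarrow> Ck_on k S (f i)"
  shows "Ck_on k S (\<lambda>x. \<Sum>i\<in>I. f i x)"
  using assms(2)
  by (induction I rule: infinite_finite_induct) (auto intro!: Ck_on_add Ck_on_const assms(1))

lemma Ck_on_prod: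
  fixes f :: "'i \<Rightarrow> 'a::euclidean_space \<Rightarrow> real"
  assumes "open S" "\<And>i. i \<in> I \<Longrightarrow> Ck_on k S (f i)"
  shows "Ck_on k S (\<lambda>x. \<Prod>i\<in>I. f i x)"
  using assms(2)
  by (induction I rule: infinite_finite_induct) (auto intro!: Ck_on_mult Ck_on_const assms(1))

lemma Ck_on_componentwise:
  fixes f :: "'a::euclidean_space \<Rightarrow> 'b::euclidean_space"
  assumes "open S" "\<And>b. b \<in> Basis \<Longrightarrow> Ck_on k S (\<lambda>x. f x \<bullet> b)"
  shows "Ck_on k S f"
proof -
  have "Ck_on k S (\<lambda>x. \<Sum>b\<in>Basis. (f x \<bullet> b) *\<^sub>R b)"
    using assms by (intro Ck_on_sum Ck_on_scaleR Ck_on_const)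
  then show ?thesis by (simp add: euclidean_representation)
qed

lemma Ck_on_vec_nth:
  "open S \<Longrightarrow> Ck_on k S f \<Longrightarrow> Ck_on k S (\<lambda>x. f x $ i)"
  by (rule Ck_on_bounded_linear[OF bounded_linear_vec_nth])

lemma Ck_on_vec:
  fixes f :: "'a::euclidean_space \<Rightarrow> 'b::euclidean_space ^ 'n"
  assumes "open S" "\<And>i. Ck_on k S (\<lambda>x. f x $ i)"
  shows "Ck_on k S f"
proof (rule Ck_on_componentwise[OF assms(1)])
  fix b :: "'b ^ 'n" assume "b \<in> Basis"
  then obtain i u where b: "b = axis i u" by (auto simp: Basis_vec_def)
  show "Ck_on k S (\<lambda>x. f x \<bullet> b)"
    unfolding b inner_axis
    by (intro Ck_on_bounded_linear[OF bounded_linear_inner_left] assms)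
qed

lemma Ck_on_compose:
  fixes f :: "'a::euclidean_space \<Rightarrow> 'b::euclidean_space"
    and h :: "'b \<Rightarrow> 'c::real_normed_vector"
  assumes "open S" "open T" "f ` S \<subseteq> T" "Ck_on k S f" "Ck_on k T h"
  shows "Ck_on k S (\<lambda>x. h (f x))"
  using assms(4,5)
proof (induction k arbitrary: h)
  case 0
  then show ?case using assms(3) by (auto intro: continuous_on_compose2)
next
  case (Suc k)
  \<comment> \<open>The chain rule gives Dh(f x)(Df(x) v), whose direction moves with x, while
    \<open>Ck_on\<close> controls derivatives in fixed directions only. Expanding the direction in
    the basis leaves fixed directions with scalar coefficients.\<close>
  let ?D = "\<lambda>x v. \<Sum>b\<in>Basis. (frechet_derivative f (at x) v \<bullet> b) *\<^sub>R frechet_derivative h (at (f x)) b"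
  show ?case
  proof (rule Ck_on_SucI[OF assms(1), where f' = ?D])
    fix x assume x: "x \<in> S"
    have h: "(h has_derivative frechet_derivative h (at (f x))) (at (f x))"
      using Ck_on_has_derivative[OF Suc.prems(2)] x assms(3) by auto
    have L: "linear (frechet_derivative h (at (f x)))" using h by (rule has_derivative_linear)
    have "frechet_derivative h (at (f x)) w =
        (\<Sum>b\<in>Basis. (w \<bullet> b) *\<^sub>R frechet_derivative h (at (f x)) b)" for w
    proof -
      have "frechet_derivative h (at (f x)) (\<Sum>b\<in>Basis. (w \<bullet> b) *\<^sub>R b) =
          (\<Sum>b\<in>Basis. (w \<bullet> b) *\<^sub>R frechet_derivative h (at (f x)) b)"
        by (simp only: linear_sum[OF L] linear_scale[OF L])
      then show ?thesis by (simp only: euclidean_representation)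
    qed
    then have "?D x = frechet_derivative h (at (f x)) \<circ> frechet_derivative f (at x)"
      unfolding o_def by (intro ext) (rule sym)
    with diff_chain_at[OF Ck_on_has_derivative[OF Suc.prems(1) x] h]
    show "((\<lambda>x. h (f x)) has_derivative ?D x) (at x)" by (simp add: o_def)
  next
    fix v
    show "Ck_on k S (\<lambda>x. ?D x v)"
      using Suc.prems Ck_on_SucD[OF Suc.prems(1)]
      by (intro Ck_on_sum Ck_on_scaleR Ck_on_bounded_linear[OF bounded_linear_inner_left] Suc.IH assms(1)) auto
  qed
qed

text \<open>The derivative of 1/f is -(1/f) Df (1/f), so the induction hypothesis for 1/f itself
  pays for the next order.\<close>

lemma Ck_on_inverse:
  fixes f :: "'a::euclidean_space \<Rightarrow> real"
  assumes "open S" "Ck_on k S f" "\<And>x. x \<in> S \<Longrightarrow> f x \<noteq> 0"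
  shows "Ck_on k S (\<lambda>x. inverse (f x))"
  using assms(2)
proof (induction k)
  case 0
  then show ?case using assms(3) by (auto intro: continuous_on_inverse)
next
  case (Suc k)
  show ?case
  proof (rule Ck_on_SucI[OF assms(1)])
    show "((\<lambda>x. inverse (f x)) has_derivative
        (\<lambda>v. - (inverse (f x) * frechet_derivative f (at x) v * inverse (f x)))) (at x)" if "x \<in> S" for x
      by (rule Deriv.has_derivative_inverse[OF assms(3)[OF that] Ck_on_has_derivative[OF Suc.prems that]])
    show "Ck_on k S (\<lambda>x. - (inverse (f x) * frechet_derivative f (at x) v * inverse (f x)))" for v
      using Suc.prems Suc.IH[OF Ck_on_SucD[OF Suc.prems]]
      by (intro Ck_on_minus Ck_on_mult assms(1)) auto
  qed
qed

lemma Ck_on_divide: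
  fixes f h :: "'a::euclidean_space \<Rightarrow> real"
  assumes "open S" "Ck_on k S f" "Ck_on k S h" "\<And>x. x \<in> S \<Longrightarrow> h x \<noteq> 0"
  shows "Ck_on k S (\<lambda>x. f x / h x)"
  unfolding divide_inverse by (intro Ck_on_mult Ck_on_inverse assms)

section \<open>Smooth functions\<close>

lemma smooth_onI: "(\<And>k. Ck_on k S f) \<Longrightarrow> smooth_on S f"
  and smooth_onD: "smooth_on S f \<Longrightarrow> Ck_on k S f"
  by (auto simp: smooth_on_def)

lemma smooth_on_subset: "smooth_on S f \<Longrightarrow> T \<subseteq> S \<Longrightarrow> smooth_on T f"
  unfolding smooth_on_def using Ck_on_subset by blast

lemma smooth_on_cong: "open S \<Longrightarrow> (\<And>y. y \<in> S \<Longrightarrow> f y = h y) \<Longrightarrow> smooth_on S f \<longleftrightarrow> smooth_on S h"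
  unfolding smooth_on_def using Ck_on_cong by blast

lemma smooth_on_compose:
  fixes f :: "'a::euclidean_space \<Rightarrow> 'b::euclidean_space"
  assumes "open S" "open T" "f ` S \<subseteq> T" "smooth_on S f" "smooth_on T h"
  shows "smooth_on S (\<lambda>x. h (f x))"
  using assms(4,5) Ck_on_compose[OF assms(1-3)] unfolding smooth_on_def by blast

lemma smooth_on_const: "smooth_on S (\<lambda>x. c)"
  by (intro smooth_onI Ck_on_const)

lemma smooth_on_bounded_linear:
  "bounded_linear L \<Longrightarrow> open S \<Longrightarrow> smooth_on S f \<Longrightarrow> smooth_on S (\<lambda>x. L (f x))"
  by (simp add: smooth_on_def Ck_on_bounded_linear)

lemma smooth_on_id: "open S \<Longrightarrow> smooth_on S (\<lambda>x. x)"
  by (intro smooth_onI Ck_on_id)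

lemma smooth_on_bilinear:
  "bounded_bilinear B \<Longrightarrow> open S \<Longrightarrow> smooth_on S f \<Longrightarrow> smooth_on S h \<Longrightarrow> smooth_on S (\<lambda>x. B (f x) (h x))"
  by (simp add: smooth_on_def Ck_on_bilinear)

lemmas smooth_on_mult = smooth_on_bilinear[OF bounded_bilinear_mult]
lemmas smooth_on_scaleR = smooth_on_bilinear[OF bounded_bilinear_scaleR]

lemma smooth_on_add:
  "open S \<Longrightarrow> smooth_on S f \<Longrightarrow> smooth_on S h \<Longrightarrow> smooth_on S (\<lambda>x. f x + h x)"
  by (simp add: smooth_on_def Ck_on_add)

lemma smooth_on_diff:
  "open S \<Longrightarrow> smooth_on S f \<Longrightarrow> smooth_on S h \<Longrightarrow> smooth_on S (\<lambda>x. f x - h x)"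
  by (simp add: smooth_on_def Ck_on_diff)

lemma smooth_on_sum:
  "open S \<Longrightarrow> (\<And>i. i \<in> I \<Longrightarrow> smooth_on S (f i)) \<Longrightarrow> smooth_on S (\<lambda>x. \<Sum>i\<in>I. f i x)"
  by (simp add: smooth_on_def Ck_on_sum)

lemma smooth_on_divide:
  fixes f h :: "'a::euclidean_space \<Rightarrow> real"
  shows "open S \<Longrightarrow> smooth_on S f \<Longrightarrow> smooth_on S h \<Longrightarrow> (\<And>x. x \<in> S \<Longrightarrow> h x \<noteq> 0) \<Longrightarrow>
    smooth_on S (\<lambda>x. f x / h x)"
  by (simp add: smooth_on_def Ck_on_divide)

lemma smooth_on_vec_nth:
  "open S \<Longrightarrow> smooth_on S f \<Longrightarrow> smooth_on S (\<lambda>x. f x $ i)"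
  by (simp add: smooth_on_def Ck_on_vec_nth)

lemma smooth_on_vec:
  fixes f :: "'a::euclidean_space \<Rightarrow> 'b::euclidean_space ^ 'n"
  shows "open S \<Longrightarrow> (\<And>i. smooth_on S (\<lambda>x. f x $ i)) \<Longrightarrow> smooth_on S f"
  by (simp add: smooth_on_def Ck_on_vec)

lemma smooth_on_has_derivative:
  "smooth_on S f \<Longrightarrow> x \<in> S \<Longrightarrow> (f has_derivative frechet_derivative f (at x)) (at x)"
  using Ck_on_has_derivative[of 0] smooth_onD by blast

lemma smooth_on_differentiable: "smooth_on S f \<Longrightarrow> x \<in> S \<Longrightarrow> f differentiable (at x)"
  using smooth_on_has_derivative differentiableI by blast

lemma smooth_on_frechet_derivative:
  "smooth_on S f \<Longrightarrow> smooth_on S (\<lambda>x. frechet_derivative f (at x) v)"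
  unfolding smooth_on_def by (metis Ck_on.simps(2))

lemma smooth_on_partial: "smooth_on S f \<Longrightarrow> smooth_on S (partial i f)"
  unfolding partial_def[abs_def] by (rule smooth_on_frechet_derivative)

text \<open>Cramer's rule exhibits the entries of the inverse as quotients of polynomials.\<close>

lemma matrix_inv_component:
  fixes M :: "real ^ 'n ^ 'n"
  assumes "invertible M"
  shows "matrix_inv M $ k $ j = det (\<chi> i l. if l = k then axis j 1 $ i else M $ i $ l) / det M"
proof -
  have "M *v (matrix_inv M *v axis j 1) = axis j 1"
    by (simp add: matrix_vector_mul_assoc matrix_inv_mult[OF assms])
  moreover have "det M \<noteq> 0" using assms by (simp add: invertible_det_nz)
  ultimately have "matrix_inv M *v axis j 1 =
      (\<chi> k. det (\<chi> i l. if l = k then axis j 1 $ i else M $ i $ l) / det M)"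
    by (simp add: cramer)
  moreover have "(matrix_inv M *v axis j 1) $ k = matrix_inv M $ k $ j"
    by (simp add: matrix_vector_mult_basis column_def)
  ultimately show ?thesis by simp
qed

lemma Ck_on_det:
  fixes M :: "'a::euclidean_space \<Rightarrow> real ^ 'n ^ 'n"
  assumes "open S" "\<And>i j. Ck_on k S (\<lambda>x. M x $ i $ j)"
  shows "Ck_on k S (\<lambda>x. det (M x))"
  unfolding det_def by (intro Ck_on_sum Ck_on_mult Ck_on_prod Ck_on_const assms)

lemma smooth_on_matrix_inv:
  fixes M :: "'a::euclidean_space \<Rightarrow> real ^ 'n ^ 'n"
  assumes S: "open S" and M: "smooth_on S M" and inv: "\<And>x. x \<in> S \<Longrightarrow> invertible (M x)"
  shows "smooth_on S (\<lambda>x. matrix_inv (M x) $ i $ j)"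
proof (rule smooth_onI)
  fix k
  have M: "Ck_on k S (\<lambda>x. M x $ a $ b)" for a b
    using M by (intro Ck_on_vec_nth S) (simp add: smooth_on_def)
  let ?N = "\<lambda>x. \<chi> a l. if l = i then axis j 1 $ a else M x $ a $ l"
  have "Ck_on k S (\<lambda>x. ?N x $ a $ b)" for a b
    using M by (cases "b = i") (auto intro: Ck_on_const)
  then have "Ck_on k S (\<lambda>x. det (?N x) / det (M x))"
    using inv by (intro Ck_on_divide Ck_on_det S M) (auto simp: invertible_det_nz)
  then show "Ck_on k S (\<lambda>x. matrix_inv (M x) $ i $ j)"
    using Ck_on_cong[OF S, of "\<lambda>x. matrix_inv (M x) $ i $ j"] matrix_inv_component[OF inv] by simp
qed

subsection \<open>Directional derivatives\<close>

text \<open>The direction is the first argument, so that \<open>dir_deriv v f\<close> is again a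
  function of the point and higher derivatives are iterates.\<close>

definition dir_deriv :: "'a::euclidean_space \<Rightarrow> ('a \<Rightarrow> 'b::real_normed_vector) \<Rightarrow> 'a \<Rightarrow> 'b" where
  "dir_deriv v f x = frechet_derivative f (at x) v"

lemma dir_deriv_eqI: "(f has_derivative f') (at x) \<Longrightarrow> dir_deriv v f x = f' v"
  by (simp add: dir_deriv_def frechet_derivative_at[symmetric])

lemma has_derivative_dir_deriv:
  "smooth_on S f \<Longrightarrow> x \<in> S \<Longrightarrow> (f has_derivative (\<lambda>v. dir_deriv v f x)) (at x)"
  unfolding dir_deriv_def by (rule smooth_on_has_derivative)

lemma smooth_on_dir_deriv: "smooth_on S f \<Longrightarrow> smooth_on S (dir_deriv v f)"
  unfolding dir_deriv_def[abs_def] by (rule smooth_on_frechet_derivative)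

lemma dir_deriv_bounded_linear:
  assumes "bounded_linear L" "smooth_on S f" "x \<in> S"
  shows "dir_deriv v (\<lambda>y. L (f y)) x = L (dir_deriv v f x)"
  by (rule dir_deriv_eqI)
     (rule bounded_linear.has_derivative[OF assms(1) has_derivative_dir_deriv[OF assms(2,3)]])

lemma linear_dir_deriv: "smooth_on S f \<Longrightarrow> x \<in> S \<Longrightarrow> linear (\<lambda>v. dir_deriv v f x)"
  using has_derivative_dir_deriv has_derivative_linear by blast

lemma dir_deriv_add_dir:
  "smooth_on S f \<Longrightarrow> x \<in> S \<Longrightarrow> dir_deriv (v + w) f x = dir_deriv v f x + dir_deriv w f x"
  using linear_add[OF linear_dir_deriv] .

lemma dir_deriv_scaleR_dir:
  "smooth_on S f \<Longrightarrow> x \<in> S \<Longrightarrow> dir_deriv (r *\<^sub>R v) f x = r *\<^sub>R dir_deriv v f x"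
  using linear_scale[OF linear_dir_deriv] .

lemma dir_deriv_add:
  "smooth_on S f \<Longrightarrow> smooth_on S h \<Longrightarrow> x \<in> S \<Longrightarrow>
    dir_deriv v (\<lambda>y. f y + h y) x = dir_deriv v f x + dir_deriv v h x"
  by (intro dir_deriv_eqI has_derivative_add has_derivative_dir_deriv)

lemma dir_deriv_bilinear:
  assumes "bounded_bilinear B" "smooth_on S f" "smooth_on S h" "x \<in> S"
  shows "dir_deriv v (\<lambda>y. B (f y) (h y)) x = B (f x) (dir_deriv v h x) + B (dir_deriv v f x) (h x)"
  by (rule dir_deriv_eqI)
     (rule bounded_bilinear.FDERIV[OF assms(1) has_derivative_dir_deriv[OF assms(2,4)]
        has_derivative_dir_deriv[OF assms(3,4)]])

lemma dir_deriv_sum: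
  assumes "\<And>i. i \<in> I \<Longrightarrow> smooth_on S (f i)" "x \<in> S"
  shows "dir_deriv v (\<lambda>y. \<Sum>i\<in>I. f i y) x = (\<Sum>i\<in>I. dir_deriv v (f i) x)"
  by (rule dir_deriv_eqI) (intro has_derivative_sum has_derivative_dir_deriv[OF _ assms(2)] assms(1))

lemma dir_deriv_compose:
  assumes "smooth_on S f" "smooth_on T h" "x \<in> S" "f x \<in> T"
  shows "dir_deriv v (\<lambda>y. h (f y)) x = dir_deriv (dir_deriv v f x) h (f x)"
  using diff_chain_at[OF has_derivative_dir_deriv[OF assms(1,3)] has_derivative_dir_deriv[OF assms(2,4)]]
  by (intro dir_deriv_eqI) (simp add: o_def)

lemma dir_deriv_cong:
  "open S \<Longrightarrow> x \<in> S \<Longrightarrow> (\<And>y. y \<in> S \<Longrightarrow> f y = h y) \<Longrightarrow> dir_deriv v f x = dir_deriv v h x"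
  unfolding dir_deriv_def by (metis frechet_derivative_cong_open)

lemma dir_deriv_expand:
  fixes f :: "real ^ 'n \<Rightarrow> 'b::real_normed_vector"
  assumes "smooth_on S f" "x \<in> S"
  shows "dir_deriv v f x = (\<Sum>i\<in>UNIV. (v $ i) *\<^sub>R dir_deriv (axis i 1) f x)"
  by (rule linear_expand_axis[OF linear_dir_deriv[OF assms]])

subsection \<open>Symmetry of second derivatives\<close>

lemma DERIV_along_line:
  fixes f :: "'a::euclidean_space \<Rightarrow> real"
  assumes "smooth_on S f" "p + s *\<^sub>R u \<in> S"
  shows "((\<lambda>s. f (p + s *\<^sub>R u)) has_real_derivative dir_deriv u f (p + s *\<^sub>R u)) (at s)"
proof -
  have l: "((\<lambda>s. p + s *\<^sub>R u) has_derivative (\<lambda>h. h *\<^sub>R u)) (at s)"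
    by (auto intro!: derivative_eq_intros)
  have "((\<lambda>s. f (p + s *\<^sub>R u)) has_derivative (\<lambda>h. dir_deriv (h *\<^sub>R u) f (p + s *\<^sub>R u))) (at s)"
    using diff_chain_at[OF l has_derivative_dir_deriv[OF assms]] by (simp add: o_def)
  then show ?thesis
    unfolding has_field_derivative_def
    by (simp add: linear_scale[OF linear_dir_deriv[OF assms]] mult.commute[of _ "dir_deriv _ _ _"])
qed

text \<open>The second difference is the increment over [0, t] of \<open>?g\<close>, which is itself
  a difference in direction v. The mean value theorem in direction u and then in direction v yields
  p. The ball is large enough to contain the parallelogram spanned by t u and t v at x.\<close>

lemma second_difference_mean_value:
  fixes f :: "'a::euclidean_space \<Rightarrow> real"
  assumes f: "smooth_on S f" and S: "cball x (t * (norm u + norm v)) \<subseteq> S" and t: "t > 0"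
  shows "\<exists>p\<in>cball x (t * (norm u + norm v)).
    f (x + t *\<^sub>R u + t *\<^sub>R v) - f (x + t *\<^sub>R u) - f (x + t *\<^sub>R v) + f x = t\<^sup>2 * dir_deriv v (dir_deriv u f) p"
proof -
  have near: "x + a *\<^sub>R u + b *\<^sub>R v \<in> cball x (t * (norm u + norm v))"
    if "0 \<le> a" "a \<le> t" "0 \<le> b" "b \<le> t" for a b
  proof -
    have "norm (a *\<^sub>R u + b *\<^sub>R v) \<le> a * norm u + b * norm v"
      using norm_triangle_ineq[of "a *\<^sub>R u" "b *\<^sub>R v"] that by simp
    also have "\<dots> \<le> t * norm u + t * norm v"
      using that by (intro add_mono mult_right_mono) auto
    finally show ?thesis
      by (simp add: dist_norm algebra_simps norm_minus_commute)
  qed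
  have in_S: "x + a *\<^sub>R u + b *\<^sub>R v \<in> S" if "0 \<le> a" "a \<le> t" "0 \<le> b" "b \<le> t" for a b
    using near[OF that] S by blast
  let ?g = "\<lambda>s. f ((x + t *\<^sub>R v) + s *\<^sub>R u) - f (x + s *\<^sub>R u)"
  have "(?g has_real_derivative
      dir_deriv u f ((x + t *\<^sub>R v) + s *\<^sub>R u) - dir_deriv u f (x + s *\<^sub>R u)) (at s)"
    if "0 \<le> s" "s \<le> t" for s
    using in_S[of s t] in_S[of s 0] that t
    by (intro DERIV_diff DERIV_along_line[OF f]) (simp_all add: add_ac)
  from MVT2[OF t this] obtain \<xi> where \<xi>: "0 < \<xi>" "\<xi> < t"
    "?g t - ?g 0 = (t - 0) * (dir_deriv u f ((x + t *\<^sub>R v) + \<xi> *\<^sub>R u) - dir_deriv u f (x + \<xi> *\<^sub>R u))"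
    by blast
  have "((\<lambda>s. dir_deriv u f ((x + \<xi> *\<^sub>R u) + s *\<^sub>R v)) has_real_derivative
      dir_deriv v (dir_deriv u f) ((x + \<xi> *\<^sub>R u) + s *\<^sub>R v)) (at s)" if "0 \<le> s" "s \<le> t" for s
    using in_S[of \<xi> s] that \<xi> by (intro DERIV_along_line[OF smooth_on_dir_deriv[OF f]]) simp
  from MVT2[OF t this] obtain \<eta> where \<eta>: "0 < \<eta>" "\<eta> < t"
    "dir_deriv u f ((x + \<xi> *\<^sub>R u) + t *\<^sub>R v) - dir_deriv u f ((x + \<xi> *\<^sub>R u) + 0 *\<^sub>R v)
      = (t - 0) * dir_deriv v (dir_deriv u f) ((x + \<xi> *\<^sub>R u) + \<eta> *\<^sub>R v)" by blast
  have "?g t - ?g 0 = t\<^sup>2 * dir_deriv v (dir_deriv u f) (x + \<xi> *\<^sub>R u + \<eta> *\<^sub>R v)"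
    using \<xi>(3) \<eta>(3) by (simp add: power2_eq_square add_ac)
  then show ?thesis
    using near[of \<xi> \<eta>] \<xi> \<eta> by (intro bexI) (auto simp: algebra_simps)
qed

text \<open>Exchanging u and v leaves the second difference unchanged, so it equals t^2 times either
  mixed derivative, each at some point near x. Continuity then forces equality at x.\<close>

lemma dir_deriv_commute_real:
  fixes f :: "'a::euclidean_space \<Rightarrow> real"
  assumes S: "open S" and f: "smooth_on S f" and x: "x \<in> S"
  shows "dir_deriv u (dir_deriv v f) x = dir_deriv v (dir_deriv u f) x"
proof (rule ccontr)
  let ?a = "dir_deriv u (dir_deriv v f)" and ?b = "dir_deriv v (dir_deriv u f)"
  assume ne: "?a x \<noteq> ?b x"
  \<comment> \<open>Half the gap: two errors below e cannot bridge 2 e.\<close>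
  define e where "e = \<bar>?a x - ?b x\<bar> / 2"
  have e: "e > 0" using ne by (simp add: e_def)
  have "continuous_on S (dir_deriv u (dir_deriv v f))" for u v
    using smooth_onD[OF smooth_on_dir_deriv[OF smooth_on_dir_deriv[OF f]], of 0] by simp
  then have cont: "isCont ?a x" "isCont ?b x"
    using S x by (simp_all add: continuous_on_eq_continuous_at)
  obtain d1 where d1: "d1 > 0" "\<And>p. dist p x < d1 \<Longrightarrow> dist (?a p) (?a x) < e"
    using cont(1) e unfolding continuous_at_eps_delta by metis
  obtain d2 where d2: "d2 > 0" "\<And>p. dist p x < d2 \<Longrightarrow> dist (?b p) (?b x) < e"
    using cont(2) e unfolding continuous_at_eps_delta by metis
  obtain r where r: "r > 0" "ball x r \<subseteq> S" using S x openE by blast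
  define d where "d = min r (min d1 d2)"
  \<comment> \<open>The summand 1 keeps the denominator positive when u and v vanish, and makes t
    (|u| + |v|) strictly less than d.\<close>
  define t where "t = d / (norm u + norm v + 1)"
  have d: "d > 0" using d1 d2 r by (simp add: d_def)
  have t: "t > 0" using d by (simp add: t_def add_nonneg_pos)
  have "t * (norm u + norm v) < t * (norm u + norm v + 1)" using t by simp
  also have "\<dots> = d"
    using add_nonneg_pos[of "norm u + norm v" 1] unfolding t_def by simp
  finally have lt: "t * (norm u + norm v) < d" .
  have sub: "cball x (t * (norm u + norm v)) \<subseteq> ball x d" using lt by auto
  also have "ball x d \<subseteq> S" using r by (auto simp: d_def)
  finally have S': "cball x (t * (norm u + norm v)) \<subseteq> S" .
  obtain p where p: "p \<in> ball x d"
    "f (x + t *\<^sub>R u + t *\<^sub>R v) - f (x + t *\<^sub>R u) - f (x + t *\<^sub>R v) + f x = t\<^sup>2 * ?b p"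
    using second_difference_mean_value[OF f S' t] sub by blast
  have S'': "cball x (t * (norm v + norm u)) \<subseteq> S" using S' by (simp add: add.commute)
  obtain q where q: "q \<in> ball x d"
    "f (x + t *\<^sub>R v + t *\<^sub>R u) - f (x + t *\<^sub>R v) - f (x + t *\<^sub>R u) + f x = t\<^sup>2 * ?a q"
    using second_difference_mean_value[OF f S'' t] sub by (auto simp: add.commute)
  have "t\<^sup>2 * ?b p = t\<^sup>2 * ?a q"
    unfolding p(2)[symmetric] q(2)[symmetric] by (simp add: add_ac)
  then have "?b p = ?a q" using t by simp
  moreover have "\<bar>?b p - ?b x\<bar> < e" "\<bar>?a q - ?a x\<bar> < e"
    using p(1) q(1) d1 d2 by (auto simp: d_def dist_commute simp flip: dist_real_def)
  moreover have "\<bar>?a x - ?b x\<bar> = 2 * e" by (simp add: e_def)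
  ultimately show False by linarith
qed

lemma dir_deriv_commute:
  fixes f :: "'a::euclidean_space \<Rightarrow> 'b::euclidean_space"
  assumes S: "open S" and f: "smooth_on S f" and x: "x \<in> S"
  shows "dir_deriv u (dir_deriv v f) x = dir_deriv v (dir_deriv u f) x"
proof (rule euclidean_eqI)
  fix b :: 'b assume "b \<in> Basis"
  note L = bounded_linear_inner_left[of b]
  have fb: "smooth_on S (\<lambda>y. f y \<bullet> b)"
    by (rule smooth_on_bounded_linear[OF L S f])
  have "dir_deriv u (dir_deriv v f) x \<bullet> b = dir_deriv u (dir_deriv v (\<lambda>y. f y \<bullet> b)) x" for u v
  proof -
    have "dir_deriv u (dir_deriv v f) x \<bullet> b = dir_deriv u (\<lambda>y. dir_deriv v f y \<bullet> b) x"
      by (rule dir_deriv_bounded_linear[OF L smooth_on_dir_deriv[OF f] x, symmetric])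
    also have "\<dots> = dir_deriv u (dir_deriv v (\<lambda>y. f y \<bullet> b)) x"
      using dir_deriv_bounded_linear[OF L f] by (intro dir_deriv_cong[OF S x]) simp
    finally show ?thesis .
  qed
  then show "dir_deriv u (dir_deriv v f) x \<bullet> b = dir_deriv v (dir_deriv u f) x \<bullet> b"
    using dir_deriv_commute_real[OF S fb x] by simp
qed

section \<open>Naturality of the curvature tensor\<close>

lemma bounded_bilinear_matrix_vector_mult:
  "bounded_bilinear (\<lambda>(A :: real ^ 'n ^ 'm) v. A *v v)"
  unfolding bilinear_conv_bounded_bilinear[symmetric] bilinear_def
  by (auto intro!: linearI simp: matrix_vector_mult_add_rdistrib matrix_vector_right_distrib
      scaleR_matrix_vector_assoc[symmetric] matrix_vector_mult_scaleR)

section \<open>The Levi-Civita connection and curvature on an open subset of coordinate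
  space\<close>

definition christoffel_vec ::
  "(real ^ 'n \<Rightarrow> real ^ 'n ^ 'n) \<Rightarrow> real ^ 'n \<Rightarrow> 'n::finite \<Rightarrow> 'n \<Rightarrow> real ^ 'n" where
  "christoffel_vec G y i j = (\<chi> k. christoffel G y k i j)"

text \<open>The bilinear extension \<Gamma>(u, v), which is the difference between the covariant and
  the coordinate derivative. It will be evaluated on the columns of a Jacobian, which are not
  coordinate vectors.\<close>

definition christoffel_form ::
  "(real ^ 'n \<Rightarrow> real ^ 'n ^ 'n) \<Rightarrow> real ^ 'n \<Rightarrow> real ^ 'n \<Rightarrow> real ^ 'n \<Rightarrow> real ^ 'n::finite" where
  "christoffel_form G y u v = (\<Sum>i\<in>UNIV. \<Sum>j\<in>UNIV. (u $ i * v $ j) *\<^sub>R christoffel_vec G y i j)"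

lemma christoffel_form_linear:
  "christoffel_form G y (u + u') v = christoffel_form G y u v + christoffel_form G y u' v"
  "christoffel_form G y (r *\<^sub>R u) v = r *\<^sub>R christoffel_form G y u v"
  "christoffel_form G y u (v + v') = christoffel_form G y u v + christoffel_form G y u v'"
  "christoffel_form G y u (r *\<^sub>R v) = r *\<^sub>R christoffel_form G y u v"
  by (simp_all add: christoffel_form_def algebra_simps sum.distrib scaleR_sum_right)

lemma christoffel_form_axis:
  "christoffel_form G y (axis i 1) (axis j 1) = christoffel_vec G y i j"
proof -
  have *: "(axis i (1::real) $ a * axis j 1 $ b) *\<^sub>R w = (if b = j then (if a = i then w else 0) else 0)"
    for a b and w :: "real ^ 'a"
    by (simp add: axis_def)
  show ?thesis unfolding christoffel_form_def * by simp
qed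

locale local_metric =
  fixes U :: "(real ^ 'n::finite) set" and G :: "real ^ 'n \<Rightarrow> real ^ 'n ^ 'n"
  assumes open_dom: "open U" and smooth_metric: "smooth_on U G"
    and sym: "\<And>y. y \<in> U \<Longrightarrow> transpose (G y) = G y"
    and inv: "\<And>y. y \<in> U \<Longrightarrow> invertible (G y)"
begin

lemma smooth_on_component: "smooth_on U (\<lambda>y. G y $ i $ j)"
  by (intro smooth_on_vec_nth open_dom smooth_metric)

lemma smooth_on_christoffel: "smooth_on U (\<lambda>y. christoffel G y k i j)"
  unfolding christoffel_def
  by (intro smooth_on_mult smooth_on_sum smooth_on_diff smooth_on_add smooth_on_const
      smooth_on_partial[OF smooth_on_component] smooth_on_matrix_inv smooth_metric inv open_dom)

lemma smooth_on_christoffel_vec: "smooth_on U (\<lambda>y. christoffel_vec G y i j)"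
  by (rule smooth_on_vec[OF open_dom]) (simp add: christoffel_vec_def smooth_on_christoffel)

lemma smooth_on_christoffel_form: "smooth_on U (\<lambda>y. christoffel_form G y v w)"
  unfolding christoffel_form_def
  by (intro smooth_on_sum smooth_on_scaleR smooth_on_const smooth_on_christoffel_vec open_dom)

lemma smooth_on_curvature04: "smooth_on U (\<lambda>y. curvature04 G y i j k l)"
  unfolding curvature04_def curvature13_def
  by (intro smooth_on_mult smooth_on_sum smooth_on_diff smooth_on_add
      smooth_on_partial[OF smooth_on_christoffel] smooth_on_component smooth_on_christoffel open_dom)

lemma smooth_on_local_curvature_norm_sq: "smooth_on U (local_curvature_norm_sq G)"
  unfolding local_curvature_norm_sq_def[abs_def]
  by (intro smooth_on_mult smooth_on_sum smooth_on_curvature04 smooth_on_matrix_inv smooth_metric inv open_dom)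

lemma christoffel_sym: "y \<in> U \<Longrightarrow> christoffel G y k i j = christoffel G y k j i"
  using levi_civita_iff[where S = U and G = G and x = y and \<Gamma> = "christoffel G y"] open_dom sym inv by blast

lemma christoffel_form_sym: "y \<in> U \<Longrightarrow> christoffel_form G y u v = christoffel_form G y v u"
  unfolding christoffel_form_def christoffel_vec_def
  by (subst sum.swap) (simp add: christoffel_sym[of y _ _ _] mult.commute)

text \<open>This is \<nabla>G = 0 for arbitrary vectors. \<open>levi_civita_iff\<close> supplies the
  case of coordinate vectors, and both sides are linear in each of u, v and w.\<close>

lemma metric_compatible:
  assumes y: "y \<in> U"
  shows "u \<bullet> (dir_deriv w G y *v v) =
    christoffel_form G y w u \<bullet> (G y *v v) + u \<bullet> (G y *v christoffel_form G y w v)"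
proof -
  note simps = christoffel_form_linear algebra_simps inner_simps matrix_vector_right_distrib
    matrix_vector_mult_scaleR matrix_vector_mult_add_rdistrib scaleR_matrix_vector_assoc[symmetric]
    dir_deriv_add_dir[OF smooth_metric y] dir_deriv_scaleR_dir[OF smooth_metric y]
  have axis: "axis i 1 \<bullet> (dir_deriv (axis k 1) G y *v axis j 1) =
    christoffel_form G y (axis k 1) (axis i 1) \<bullet> (G y *v axis j 1)
     + axis i 1 \<bullet> (G y *v christoffel_form G y (axis k 1) (axis j 1))" for k i j
  proof -
    have "axis i 1 \<bullet> (dir_deriv (axis k 1) G y *v axis j 1) = dir_deriv (axis k 1) G y $ i $ j"
      by (simp add: inner_axis' matrix_vector_mult_basis column_def)
    also have "\<dots> = dir_deriv (axis k 1) (\<lambda>z. G z $ i $ j) y"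
      using dir_deriv_bounded_linear[OF bounded_linear_compose[OF bounded_linear_vec_nth bounded_linear_vec_nth] smooth_metric y,
          of "axis k 1" i j] by simp
    also have "\<dots> = (\<Sum>l\<in>UNIV. christoffel G y l k i * G y $ l $ j + christoffel G y l k j * G y $ i $ l)"
      using levi_civita_iff[where S = U and G = G and x = y and \<Gamma> = "christoffel G y", OF open_dom y sym inv[OF y]]
      unfolding dir_deriv_def partial_def by simp
    also have "\<dots> = christoffel_vec G y k i \<bullet> column j (G y) + (G y *v christoffel_vec G y k j) $ i"
      by (simp add: christoffel_vec_def inner_vec_def column_def matrix_vector_mult_def sum.distrib mult.commute)
    finally show ?thesis by (simp add: inner_axis' matrix_vector_mult_basis christoffel_form_axis)
  qed
  \<comment> \<open>From here on v, u and w are released from the coordinate vectors one after the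
    other.\<close>
  have 1: "axis i 1 \<bullet> (dir_deriv (axis k 1) G y *v v) =
    christoffel_form G y (axis k 1) (axis i 1) \<bullet> (G y *v v)
     + axis i 1 \<bullet> (G y *v christoffel_form G y (axis k 1) v)" for k i
  proof (rule linear_eq_on_axis[of _ _ v], goal_cases)
    case (3 i)
    show ?case by (rule axis)
  qed (auto intro!: linearI simp: simps)
  have 2: "u \<bullet> (dir_deriv (axis k 1) G y *v v) =
    christoffel_form G y (axis k 1) u \<bullet> (G y *v v) + u \<bullet> (G y *v christoffel_form G y (axis k 1) v)" for k
  proof (rule linear_eq_on_axis[of _ _ u], goal_cases)
    case (3 i)
    show ?case by (rule 1)
  qed (auto intro!: linearI simp: simps)
  show ?thesis
  proof (rule linear_eq_on_axis[of _ _ w], goal_cases)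
    case (3 i)
    show ?case by (rule 2)
  qed (auto intro!: linearI simp: simps)
qed

end

text \<open>\<open>curvature_form G y u v w\<close> is \<open>R(u, v) w\<close>; \<open>half_curvature\<close> is the part of it which is
  antisymmetrized in \<open>u\<close> and \<open>v\<close>.\<close>

definition half_curvature ::
  "(real ^ 'n \<Rightarrow> real ^ 'n ^ 'n) \<Rightarrow> real ^ 'n \<Rightarrow> real ^ 'n \<Rightarrow> real ^ 'n \<Rightarrow> real ^ 'n \<Rightarrow> real ^ 'n::finite" where
  "half_curvature G y u v w =
     dir_deriv u (\<lambda>z. christoffel_form G z v w) y + christoffel_form G y u (christoffel_form G y v w)"

definition curvature_form ::
  "(real ^ 'n \<Rightarrow> real ^ 'n ^ 'n) \<Rightarrow> real ^ 'n \<Rightarrow> real ^ 'n \<Rightarrow> real ^ 'n \<Rightarrow> real ^ 'n \<Rightarrow> real ^ 'n::finite" where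
  "curvature_form G y u v w = half_curvature G y u v w - half_curvature G y v u w"

context local_metric
begin

text \<open>The arguments are constant vectors, so moving the base point produces no derivatives of
  them. This is also why the curvature has no term with the bracket of u and v.\<close>

lemma half_curvature_linear:
  assumes y: "y \<in> U"
  shows "half_curvature G y (u + u') v w = half_curvature G y u v w + half_curvature G y u' v w"
    "half_curvature G y (r *\<^sub>R u) v w = r *\<^sub>R half_curvature G y u v w"
    "half_curvature G y u (v + v') w = half_curvature G y u v w + half_curvature G y u v' w"
    "half_curvature G y u (r *\<^sub>R v) w = r *\<^sub>R half_curvature G y u v w"
    "half_curvature G y u v (w + w') = half_curvature G y u v w + half_curvature G y u v w'"
    "half_curvature G y u v (r *\<^sub>R w) = r *\<^sub>R half_curvature G y u v w"
  unfolding half_curvature_def christoffel_form_linear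
  by (simp_all add: dir_deriv_add_dir[OF smooth_on_christoffel_form y] dir_deriv_scaleR_dir[OF smooth_on_christoffel_form y]
      dir_deriv_add[OF smooth_on_christoffel_form smooth_on_christoffel_form y]
      dir_deriv_bounded_linear[OF bounded_linear_scaleR_right smooth_on_christoffel_form y]
      christoffel_form_linear algebra_simps)

lemma curvature_form_linear:
  assumes y: "y \<in> U"
  shows "linear (\<lambda>u. curvature_form G y u v w)" "linear (\<lambda>v. curvature_form G y u v w)"
    "linear (\<lambda>w. curvature_form G y u v w)"
  unfolding curvature_form_def
  by (auto intro!: linearI simp: half_curvature_linear[OF y] algebra_simps)

lemma curvature_form_axis:
  assumes y: "y \<in> U"
  shows "curvature_form G y (axis i 1) (axis j 1) (axis k 1) $ l = curvature13 G y i j k l"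
proof -
  have "half_curvature G y (axis i 1) (axis j 1) (axis k 1) $ l = partial i (\<lambda>z. christoffel G z l j k) y
     + (\<Sum>m\<in>UNIV. christoffel G y m j k * christoffel G y l i m)" for i j
  proof -
    have "dir_deriv (axis i 1) (\<lambda>z. christoffel_vec G z j k) y $ l = partial i (\<lambda>z. christoffel G z l j k) y"
      using dir_deriv_bounded_linear[OF bounded_linear_vec_nth smooth_on_christoffel_vec[of j k] y, of "axis i 1" l]
      by (simp add: partial_def dir_deriv_def christoffel_vec_def)
    moreover have "christoffel_form G y (axis i 1) (christoffel_vec G y j k)
      = (\<Sum>m\<in>UNIV. christoffel_vec G y j k $ m *\<^sub>R christoffel_vec G y i m)"
      using linear_expand_axis[of "christoffel_form G y (axis i 1)" "christoffel_vec G y j k"]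
      by (simp add: christoffel_form_axis linearI christoffel_form_linear)
    ultimately show ?thesis
      by (simp add: half_curvature_def christoffel_form_axis) (simp add: christoffel_vec_def)
  qed
  then show ?thesis
    by (simp add: curvature_form_def curvature13_def sum_subtractf)
qed

text \<open>Each index carries its coefficient at its own level of nesting. After a pull-back the
  coefficients become Jacobian entries, and \<open>contract_pull\<close> removes them level by
  level.\<close>

lemma curvature04_form:
  assumes y: "y \<in> U"
  shows "z \<bullet> (G y *v curvature_form G y u v w) =
    (\<Sum>i\<in>UNIV. u $ i * (\<Sum>j\<in>UNIV. v $ j * (\<Sum>k\<in>UNIV. w $ k * (\<Sum>l\<in>UNIV. z $ l * curvature04 G y i j k l))))"
proof -
  let ?F = "\<lambda>u v w z. z \<bullet> (G y *v curvature_form G y u v w)"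
  note L = curvature_form_linear[OF y]
  have "linear (\<lambda>u. ?F u v w z)" "linear (\<lambda>v. ?F u v w z)" "linear (\<lambda>w. ?F u v w z)" "linear (\<lambda>z. ?F u v w z)" for u v w z
    using linear_add[OF L(1)] linear_scale[OF L(1)] linear_add[OF L(2)] linear_scale[OF L(2)]
      linear_add[OF L(3)] linear_scale[OF L(3)]
    by (auto intro!: linearI simp: matrix_vector_right_distrib inner_simps matrix_vector_mult_scaleR)
  note E = this[THEN linear_expand_axis]
  have "?F (axis i 1) (axis j 1) (axis k 1) (axis l 1) = curvature04 G y i j k l" for i j k l
    by (simp add: inner_axis' matrix_vector_mult_def curvature04_def curvature_form_axis[OF y])
  then have "?F (axis i 1) (axis j 1) (axis k 1) z = (\<Sum>l\<in>UNIV. z $ l * curvature04 G y i j k l)" for i j k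
    using E(4)[of z "axis i 1" "axis j 1" "axis k 1"] by simp
  then have "?F (axis i 1) (axis j 1) w z = (\<Sum>k\<in>UNIV. w $ k * (\<Sum>l\<in>UNIV. z $ l * curvature04 G y i j k l))" for i j
    using E(3)[of z "axis i 1" "axis j 1" w] by simp
  then have "?F (axis i 1) v w z = (\<Sum>j\<in>UNIV. v $ j * (\<Sum>k\<in>UNIV. w $ k * (\<Sum>l\<in>UNIV. z $ l * curvature04 G y i j k l)))" for i
    using E(2)[of z "axis i 1" v w] by simp
  then show ?thesis using E(1)[of z u v w] by simp
qed

end


section \<open>Smooth maps that pull one metric back to another\<close>

locale metric_pullback = dom: local_metric U G + cod: local_metric V H
  for U :: "(real ^ 'n::finite) set" and G V H +
  fixes \<phi> :: "real ^ 'n \<Rightarrow> real ^ 'n"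
  assumes smooth_map: "smooth_on U \<phi>" and maps_to: "x \<in> U \<Longrightarrow> \<phi> x \<in> V"
    and pull: "x \<in> U \<Longrightarrow> transpose (jacobian \<phi> (at x)) ** H (\<phi> x) ** jacobian \<phi> (at x) = G x"
begin

abbreviation d\<phi> :: "'n \<Rightarrow> real ^ 'n \<Rightarrow> real ^ 'n" where
  "d\<phi> i \<equiv> dir_deriv (axis i 1) \<phi>"

lemma smooth_d\<phi>: "smooth_on U (d\<phi> i)"
  by (rule smooth_on_dir_deriv[OF smooth_map])

lemma dir_deriv_jacobian: "x \<in> U \<Longrightarrow> dir_deriv v \<phi> x = jacobian \<phi> (at x) *v v"
  using jacobian_works[of \<phi> "at x"] smooth_on_differentiable[OF smooth_map] dir_deriv_eqI by blast

lemma jacobian_component: "x \<in> U \<Longrightarrow> jacobian \<phi> (at x) $ a $ i = d\<phi> i x $ a"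
  by (simp add: dir_deriv_jacobian matrix_vector_mult_basis column_def)

lemma pull_form:
  assumes x: "x \<in> U"
  shows "v \<bullet> (G x *v w) = dir_deriv v \<phi> x \<bullet> (H (\<phi> x) *v dir_deriv w \<phi> x)"
  unfolding pull[OF x, symmetric] dir_deriv_jacobian[OF x] matrix_vector_mul_assoc[symmetric]
  by (simp add: dot_lmul_matrix[symmetric] flip: transpose_matrix_vector)

text \<open>Take determinants in J^T H J = G: since det G is nonzero, so is det J. No inverse of
  \<phi> has to be carried along.\<close>

lemma invertible_jacobian:
  assumes x: "x \<in> U"
  shows "invertible (jacobian \<phi> (at x))"
proof -
  have "det (G x) = det (jacobian \<phi> (at x)) * det (H (\<phi> x)) * det (jacobian \<phi> (at x))"
    unfolding pull[OF x, symmetric] by (simp add: det_mul det_transpose)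
  then show ?thesis using dom.inv[OF x] by (auto simp: invertible_det_nz)
qed

text \<open>A direct comparison of the two Christoffel formulas would mix inverse metrics with
  derivatives of the Jacobian. Instead the right side, which is the covariant derivative along
  \<phi> of the j-th Jacobian column, is moved back to the source and tested against the properties
  that determine the connection of G.\<close>

lemma christoffel_pullback:
  assumes x: "x \<in> U"
  shows "dir_deriv (christoffel_vec G x i j) \<phi> x =
    dir_deriv (axis i 1) (d\<phi> j) x + christoffel_form H (\<phi> x) (d\<phi> i x) (d\<phi> j x)"
proof -
  let ?J = "jacobian \<phi> (at x)"
  define R where "R i j = dir_deriv (axis i 1) (d\<phi> j) x + christoffel_form H (\<phi> x) (d\<phi> i x) (d\<phi> j x)" for i j
  \<comment> \<open>The candidate for the covariant derivative of the j-th coordinate field in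
    direction i: the vector that the Jacobian maps to \<open>R i j\<close>.\<close>
  define W where "W i j = matrix_inv ?J *v R i j" for i j
  have JW: "dir_deriv (W i j) \<phi> x = R i j" for i j
    by (simp add: dir_deriv_jacobian[OF x] W_def matrix_vector_mul_assoc matrix_inv_mult[OF invertible_jacobian[OF x]])
  have "W k i = W i k" for i k
    unfolding W_def R_def dir_deriv_commute[OF dom.open_dom smooth_map x, of "axis k 1"]
      cod.christoffel_form_sym[OF maps_to[OF x], of "d\<phi> k x"] ..
  moreover have "partial k (\<lambda>y. G y $ i $ j) x = (\<Sum>l\<in>UNIV. W k i $ l * G x $ l $ j + W k j $ l * G x $ i $ l)" for k i j
  proof -
    have comp: "G y $ i $ j = d\<phi> i y \<bullet> (H (\<phi> y) *v d\<phi> j y)" if "y \<in> U" for y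
      unfolding pull_form[OF that, symmetric] by (simp add: inner_axis' matrix_vector_mult_basis column_def)
    have H\<phi>: "smooth_on U (\<lambda>y. H (\<phi> y))"
      using maps_to by (intro smooth_on_compose[OF dom.open_dom cod.open_dom _ smooth_map cod.smooth_metric]) auto
    have "partial k (\<lambda>y. G y $ i $ j) x = dir_deriv (axis k 1) (\<lambda>y. d\<phi> i y \<bullet> (H (\<phi> y) *v d\<phi> j y)) x"
      unfolding partial_def dir_deriv_def[symmetric] by (rule dir_deriv_cong[OF dom.open_dom x comp])
    also have "\<dots> = d\<phi> i x \<bullet> (H (\<phi> x) *v dir_deriv (axis k 1) (d\<phi> j) x + dir_deriv (d\<phi> k x) H (\<phi> x) *v d\<phi> j x)
        + dir_deriv (axis k 1) (d\<phi> i) x \<bullet> (H (\<phi> x) *v d\<phi> j x)"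
      by (simp add: dir_deriv_bilinear[OF bounded_bilinear_inner smooth_d\<phi>
              smooth_on_bilinear[OF bounded_bilinear_matrix_vector_mult dom.open_dom H\<phi> smooth_d\<phi>] x]
            dir_deriv_bilinear[OF bounded_bilinear_matrix_vector_mult H\<phi> smooth_d\<phi> x]
            dir_deriv_compose[OF smooth_map cod.smooth_metric x maps_to[OF x]])
    \<comment> \<open>\<open>metric_compatible\<close> splits the derivative of H into two
      Christoffel terms, and each completes one of the second derivatives of \<phi> to an
      \<open>R\<close>.\<close>
    also have "\<dots> = R k i \<bullet> (H (\<phi> x) *v d\<phi> j x) + d\<phi> i x \<bullet> (H (\<phi> x) *v R k j)"
      by (simp add: inner_add_right inner_add_left matrix_vector_right_distrib R_def
          cod.metric_compatible[OF maps_to[OF x]])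
    also have "\<dots> = W k i \<bullet> (G x *v axis j 1) + axis i 1 \<bullet> (G x *v W k j)"
      unfolding pull_form[OF x] JW ..
    also have "\<dots> = (\<Sum>l\<in>UNIV. W k i $ l * G x $ l $ j + W k j $ l * G x $ i $ l)"
      by (simp add: inner_axis' matrix_vector_mult_basis)
        (simp add: column_def inner_vec_def matrix_vector_mult_def sum.distrib mult.commute)
    finally show ?thesis .
  qed
  \<comment> \<open>The pulled-back connection is torsion free and metric, so it is the Levi-Civita connection.\<close>
  ultimately have "(\<lambda>l k i. W k i $ l) = christoffel G x"
    using levi_civita_iff[where S = U and G = G and x = x and \<Gamma> = "\<lambda>l k i. W k i $ l",
        OF dom.open_dom x dom.sym dom.inv[OF x]] by simp
  from fun_cong[OF fun_cong[OF fun_cong[OF this]]] have "christoffel_vec G x i j = W i j"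
    by (simp add: christoffel_vec_def vec_eq_iff)
  then show ?thesis by (simp add: JW R_def)
qed

text \<open>In coordinates the form is a sum of products of three functions of x. The terms come
  from differentiating the base point with both arguments frozen, and then each argument in
  turn.\<close>

lemma dir_deriv_christoffel_form:
  assumes "smooth_on U a" "smooth_on U b" and x: "x \<in> U"
  shows "dir_deriv v (\<lambda>x. christoffel_form H (\<phi> x) (a x) (b x)) x =
    dir_deriv (dir_deriv v \<phi> x) (\<lambda>y. christoffel_form H y (a x) (b x)) (\<phi> x)
    + christoffel_form H (\<phi> x) (dir_deriv v a x) (b x) + christoffel_form H (\<phi> x) (a x) (dir_deriv v b x)"
proof -
  note ab = smooth_on_vec_nth[OF dom.open_dom assms(1)] smooth_on_vec_nth[OF dom.open_dom assms(2)]
  have C: "smooth_on U (\<lambda>x. christoffel_vec H (\<phi> x) i j)" for i j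
    using maps_to
    by (intro smooth_on_compose[OF dom.open_dom cod.open_dom _ smooth_map cod.smooth_on_christoffel_vec]) auto
  have nth: "dir_deriv v (\<lambda>x. f x $ i) x = dir_deriv v f x $ i" if "smooth_on U f"
    for f :: "real ^ 'n \<Rightarrow> real ^ 'n" and i
    by (rule dir_deriv_bounded_linear[OF bounded_linear_vec_nth that x])
  have s: "smooth_on U (\<lambda>x. (a x $ i * b x $ j) *\<^sub>R christoffel_vec H (\<phi> x) i j)" for i j
    by (intro smooth_on_scaleR smooth_on_mult ab C dom.open_dom)
  have s': "smooth_on V (\<lambda>y. (a x $ i * b x $ j) *\<^sub>R christoffel_vec H y i j)" for i j
    by (intro smooth_on_scaleR smooth_on_const cod.smooth_on_christoffel_vec cod.open_dom)
  have "dir_deriv v (\<lambda>x. (a x $ i * b x $ j) *\<^sub>R christoffel_vec H (\<phi> x) i j) x =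
      (a x $ i * b x $ j) *\<^sub>R dir_deriv (dir_deriv v \<phi> x) (\<lambda>y. christoffel_vec H y i j) (\<phi> x)
      + (a x $ i * dir_deriv v b x $ j + dir_deriv v a x $ i * b x $ j) *\<^sub>R christoffel_vec H (\<phi> x) i j" for i j
    unfolding dir_deriv_bilinear[OF bounded_bilinear_scaleR smooth_on_mult[OF dom.open_dom ab] C x]
      dir_deriv_bilinear[OF bounded_bilinear_mult ab x] nth[OF assms(1)] nth[OF assms(2)]
      dir_deriv_compose[OF smooth_map cod.smooth_on_christoffel_vec x maps_to[OF x]] ..
  then have "dir_deriv v (\<lambda>x. christoffel_form H (\<phi> x) (a x) (b x)) x =
    (\<Sum>i\<in>UNIV. \<Sum>j\<in>UNIV. (a x $ i * b x $ j) *\<^sub>R dir_deriv (dir_deriv v \<phi> x) (\<lambda>y. christoffel_vec H y i j) (\<phi> x)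
      + (a x $ i * dir_deriv v b x $ j + dir_deriv v a x $ i * b x $ j) *\<^sub>R christoffel_vec H (\<phi> x) i j)"
    unfolding christoffel_form_def
    by (simp only: dir_deriv_sum[OF smooth_on_sum[OF dom.open_dom s] x] dir_deriv_sum[OF s x])
  moreover have "dir_deriv w (\<lambda>y. christoffel_form H y (a x) (b x)) (\<phi> x) =
    (\<Sum>i\<in>UNIV. \<Sum>j\<in>UNIV. (a x $ i * b x $ j) *\<^sub>R dir_deriv w (\<lambda>y. christoffel_vec H y i j) (\<phi> x))" for w
    unfolding christoffel_form_def
    by (simp only: dir_deriv_sum[OF smooth_on_sum[OF cod.open_dom s'] maps_to[OF x]] dir_deriv_sum[OF s' maps_to[OF x]]
        dir_deriv_bounded_linear[OF bounded_linear_scaleR_right cod.smooth_on_christoffel_vec maps_to[OF x]])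
  ultimately show ?thesis
    by (simp add: christoffel_form_def sum.distrib scaleR_add_left add_ac)
qed

text \<open>Apart from the first one, the terms on the right are symmetric in \<open>m\<close> and \<open>i\<close>, and thus
  drop out of the curvature.\<close>

lemma half_curvature_pullback:
  assumes x: "x \<in> U"
  shows "dir_deriv (half_curvature G x (axis m 1) (axis i 1) (axis j 1)) \<phi> x =
    half_curvature H (\<phi> x) (d\<phi> m x) (d\<phi> i x) (d\<phi> j x)
    + dir_deriv (axis m 1) (dir_deriv (axis i 1) (d\<phi> j)) x
    + christoffel_form H (\<phi> x) (dir_deriv (axis m 1) (d\<phi> i) x) (d\<phi> j x)
    + (christoffel_form H (\<phi> x) (d\<phi> i x) (dir_deriv (axis m 1) (d\<phi> j) x)
      + christoffel_form H (\<phi> x) (d\<phi> m x) (dir_deriv (axis i 1) (d\<phi> j) x))"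
proof -
  define c where "c = christoffel_vec G x i j"
  \<comment> \<open>\<open>K\<close> arises when the derivative falls on a column of the Jacobian.
    It enters with a minus sign through the derivative of the Christoffel vector and with a plus
    sign through the quadratic term, and so drops out of the sum.\<close>
  define K where "K = (\<Sum>k\<in>UNIV. c $ k *\<^sub>R dir_deriv (axis m 1) (d\<phi> k) x)"
  note lin = linear_dir_deriv[OF smooth_map x]
  have cs: "smooth_on U (\<lambda>y. christoffel_vec G y i j $ k)" for k
    by (rule smooth_on_vec_nth[OF dom.open_dom dom.smooth_on_christoffel_vec])
  have "dir_deriv (axis m 1) (\<lambda>y. dir_deriv (christoffel_vec G y i j) \<phi> y) x =
      dir_deriv (axis m 1) (\<lambda>y. \<Sum>k\<in>UNIV. christoffel_vec G y i j $ k *\<^sub>R d\<phi> k y) x"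
    by (rule dir_deriv_cong[OF dom.open_dom x]) (rule dir_deriv_expand[OF smooth_map])
  also have "\<dots> = (\<Sum>k\<in>UNIV. c $ k *\<^sub>R dir_deriv (axis m 1) (d\<phi> k) x
      + dir_deriv (axis m 1) (\<lambda>y. christoffel_vec G y i j) x $ k *\<^sub>R d\<phi> k x)"
    by (simp add: dir_deriv_sum[OF smooth_on_scaleR[OF dom.open_dom cs smooth_d\<phi>] x] c_def
        dir_deriv_bilinear[OF bounded_bilinear_scaleR cs smooth_d\<phi> x]
        dir_deriv_bounded_linear[OF bounded_linear_vec_nth dom.smooth_on_christoffel_vec x])
  also have "\<dots> = K + dir_deriv (dir_deriv (axis m 1) (\<lambda>y. christoffel_vec G y i j) x) \<phi> x"
    unfolding sum.distrib K_def dir_deriv_expand[OF smooth_map x, symmetric] ..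
  finally have 1: "dir_deriv (axis m 1) (\<lambda>y. dir_deriv (christoffel_vec G y i j) \<phi> y) x =
      K + dir_deriv (dir_deriv (axis m 1) (\<lambda>y. christoffel_vec G y i j) x) \<phi> x" .
  have F: "smooth_on U (\<lambda>y. christoffel_form H (\<phi> y) (d\<phi> i y) (d\<phi> j y))"
    unfolding christoffel_form_def using maps_to
    by (intro smooth_on_sum smooth_on_scaleR smooth_on_mult smooth_on_vec_nth dom.open_dom smooth_d\<phi>
        smooth_on_compose[OF dom.open_dom cod.open_dom _ smooth_map cod.smooth_on_christoffel_vec]) auto
  \<comment> \<open>A second evaluation of the derivative in 1, now through
    \<open>christoffel_pullback\<close>. Comparing the two isolates the image of the derivative of
    the Christoffel vector.\<close>
  have "dir_deriv (axis m 1) (\<lambda>y. dir_deriv (christoffel_vec G y i j) \<phi> y) x =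
      dir_deriv (axis m 1) (\<lambda>y. dir_deriv (axis i 1) (d\<phi> j) y + christoffel_form H (\<phi> y) (d\<phi> i y) (d\<phi> j y)) x"
    by (rule dir_deriv_cong[OF dom.open_dom x]) (rule christoffel_pullback)
  also have "\<dots> = dir_deriv (axis m 1) (dir_deriv (axis i 1) (d\<phi> j)) x
      + (dir_deriv (d\<phi> m x) (\<lambda>y. christoffel_form H y (d\<phi> i x) (d\<phi> j x)) (\<phi> x)
      + christoffel_form H (\<phi> x) (dir_deriv (axis m 1) (d\<phi> i) x) (d\<phi> j x)
      + christoffel_form H (\<phi> x) (d\<phi> i x) (dir_deriv (axis m 1) (d\<phi> j) x))"
    by (simp only: dir_deriv_add[OF smooth_on_dir_deriv[OF smooth_d\<phi>] F x]
        dir_deriv_christoffel_form[OF smooth_d\<phi> smooth_d\<phi> x])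
  finally have 2: "dir_deriv (dir_deriv (axis m 1) (\<lambda>y. christoffel_vec G y i j) x) \<phi> x =
      dir_deriv (axis m 1) (dir_deriv (axis i 1) (d\<phi> j)) x
      + (dir_deriv (d\<phi> m x) (\<lambda>y. christoffel_form H y (d\<phi> i x) (d\<phi> j x)) (\<phi> x)
      + christoffel_form H (\<phi> x) (dir_deriv (axis m 1) (d\<phi> i) x) (d\<phi> j x)
      + christoffel_form H (\<phi> x) (d\<phi> i x) (dir_deriv (axis m 1) (d\<phi> j) x)) - K"
    unfolding 1 by (simp add: algebra_simps)
  have lin': "linear (christoffel_form H (\<phi> x) (d\<phi> m x))" "linear (christoffel_form G x (axis m 1))"
    by (auto intro!: linearI simp: christoffel_form_linear)
  have "dir_deriv (christoffel_form G x (axis m 1) c) \<phi> x =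
      (\<Sum>k\<in>UNIV. c $ k *\<^sub>R dir_deriv (christoffel_vec G x m k) \<phi> x)"
    unfolding linear_expand_axis[OF lin'(2), of c]
    by (simp add: linear_sum[OF lin] linear_scale[OF lin] christoffel_form_axis)
  also have "\<dots> = K + (\<Sum>k\<in>UNIV. c $ k *\<^sub>R christoffel_form H (\<phi> x) (d\<phi> m x) (d\<phi> k x))"
    by (simp add: christoffel_pullback[OF x] scaleR_add_right sum.distrib K_def)
  also have "(\<Sum>k\<in>UNIV. c $ k *\<^sub>R christoffel_form H (\<phi> x) (d\<phi> m x) (d\<phi> k x)) =
      christoffel_form H (\<phi> x) (d\<phi> m x) (dir_deriv c \<phi> x)"
    unfolding dir_deriv_expand[OF smooth_map x, of c]
    by (simp add: linear_sum[OF lin'(1)] linear_scale[OF lin'(1)])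
  also have "\<dots> = christoffel_form H (\<phi> x) (d\<phi> m x) (dir_deriv (axis i 1) (d\<phi> j) x)
      + christoffel_form H (\<phi> x) (d\<phi> m x) (christoffel_form H (\<phi> x) (d\<phi> i x) (d\<phi> j x))"
    unfolding c_def christoffel_pullback[OF x] christoffel_form_linear ..
  finally show ?thesis
    unfolding half_curvature_def christoffel_form_axis linear_add[OF lin] 2 c_def[symmetric]
    by (simp add: algebra_simps)
qed

text \<open>In the difference of the half curvatures the third derivatives of \<phi> cancel, the
  single Christoffel term cancels because second derivatives commute, and the bracketed pair cancels
  because exchanging i and j swaps its members.\<close>

lemma curvature_form_pullback:
  assumes x: "x \<in> U"
  shows "dir_deriv (curvature_form G x (axis i 1) (axis j 1) (axis k 1)) \<phi> x =
    curvature_form H (\<phi> x) (d\<phi> i x) (d\<phi> j x) (d\<phi> k x)"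
proof -
  note lin = linear_dir_deriv[OF smooth_map x]
  show ?thesis
    unfolding curvature_form_def linear_diff[OF lin] half_curvature_pullback[OF x]
      dir_deriv_commute[OF dom.open_dom smooth_d\<phi> x, of "axis i 1" "axis j 1"]
      dir_deriv_commute[OF dom.open_dom smooth_map x, of "axis i 1" "axis j 1"]
    by (simp add: algebra_simps)
qed

lemma curvature04_pullback:
  assumes x: "x \<in> U"
  shows "curvature04 G x i j k l = (\<Sum>a\<in>UNIV. d\<phi> i x $ a * (\<Sum>b\<in>UNIV. d\<phi> j x $ b *
    (\<Sum>c\<in>UNIV. d\<phi> k x $ c * (\<Sum>d\<in>UNIV. d\<phi> l x $ d * curvature04 H (\<phi> x) a b c d))))"
proof -
  have "curvature04 G x i j k l = axis l 1 \<bullet> (G x *v curvature_form G x (axis i 1) (axis j 1) (axis k 1))"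
    by (simp add: curvature04_def inner_axis' matrix_vector_mult_def dom.curvature_form_axis[OF x])
  also have "\<dots> = d\<phi> l x \<bullet> (H (\<phi> x) *v curvature_form H (\<phi> x) (d\<phi> i x) (d\<phi> j x) (d\<phi> k x))"
    unfolding pull_form[OF x] curvature_form_pullback[OF x] ..
  finally show ?thesis unfolding cod.curvature04_form[OF maps_to[OF x]] .
qed

end

section \<open>Contraction with the inverse metric\<close>

definition contract :: "real ^ 'n ^ 'n \<Rightarrow> ('n \<Rightarrow> 'n \<Rightarrow> real) \<Rightarrow> real" where
  "contract P F = (\<Sum>i\<in>UNIV. \<Sum>j\<in>UNIV. P $ i $ j * F i j)"

lemma contract_swap:
  "contract P (\<lambda>i a. contract Q (\<lambda>j b. F i a j b)) = contract Q (\<lambda>j b. contract P (\<lambda>i a. F i a j b))"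
proof -
  have "contract P (\<lambda>i a. contract Q (\<lambda>j b. F i a j b)) =
      (\<Sum>(i, a, j, b)\<in>UNIV. P $ i $ a * (Q $ j $ b * F i a j b))"
    unfolding contract_def sum_distrib_left by (simp add: sum.cartesian_product)
  also have "\<dots> = (\<Sum>(j, b, i, a)\<in>UNIV. Q $ j $ b * (P $ i $ a * F i a j b))"
    by (rule sum.reindex_bij_witness[where i = "\<lambda>(j, b, i, a). (i, a, j, b)"
        and j = "\<lambda>(i, a, j, b). (j, b, i, a)"]) auto
  also have "\<dots> = contract Q (\<lambda>j b. contract P (\<lambda>i a. F i a j b))"
    unfolding contract_def sum_distrib_left by (simp add: sum.cartesian_product)
  finally show ?thesis .
qed

lemma contract_inner: "contract P (\<lambda>i a. u $ i * v $ a) = u \<bullet> (P *v v)"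
  by (simp add: contract_def inner_vec_def matrix_vector_mult_def sum_distrib_left mult.left_commute)

text \<open>Covectors pull back by J^T, and (J^T T) . P (J^T S) = T . (J P J^T) S. For P the inverse
  metric of the source, J P J^T is that of the target.\<close>

lemma contract_pull:
  assumes "J ** P ** transpose J = P'"
  shows "contract P (\<lambda>i a. (\<Sum>p\<in>UNIV. J $ p $ i * T p) * (\<Sum>q\<in>UNIV. J $ q $ a * S q)) =
    contract P' (\<lambda>p q. T p * S q)"
proof -
  have t: "(\<Sum>p\<in>UNIV. J $ p $ i * T p) = (transpose J *v (\<chi> p. T p)) $ i" for T i
    by (simp add: matrix_vector_mult_def transpose_def)
  have "contract P (\<lambda>i a. (\<Sum>p\<in>UNIV. J $ p $ i * T p) * (\<Sum>q\<in>UNIV. J $ q $ a * S q)) =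
      (\<chi> p. T p) \<bullet> (P' *v (\<chi> p. S p))"
    unfolding t contract_inner assms[symmetric] matrix_vector_mul_assoc[symmetric]
    by (simp add: dot_lmul_matrix)
  also have "\<dots> = contract P' (\<lambda>p q. T p * S q)"
    unfolding contract_inner[symmetric] by simp
  finally show ?thesis .
qed

text \<open>The eightfold sum becomes four nested contractions, each pairing an index of one factor
  with its partner in the other. Two orders are given because carrying the contractions over from G
  to H one at a time turns the first order into the second.\<close>

lemma local_curvature_norm_sq_contract:
  fixes G :: "real ^ 'n::finite \<Rightarrow> real ^ 'n ^ 'n"
  defines "P x \<equiv> matrix_inv (G x)" and "K \<equiv> curvature04 G"
  shows "local_curvature_norm_sq G x = contract (P x) (\<lambda>l d. contract (P x) (\<lambda>k c. contract (P x)
      (\<lambda>j b. contract (P x) (\<lambda>i a. K x i j k l * K x a b c d))))" (is "_ = ?r1")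
    and "local_curvature_norm_sq G x = contract (P x) (\<lambda>i a. contract (P x) (\<lambda>j b. contract (P x)
      (\<lambda>k c. contract (P x) (\<lambda>l d. K x i j k l * K x a b c d))))" (is "_ = ?r2")
proof -
  let ?t = "\<lambda>i a j b k c l d. P x $ i $ a * (P x $ j $ b * (P x $ k $ c * (P x $ l $ d * (K x i j k l * K x a b c d))))"
  have n: "local_curvature_norm_sq G x = (\<Sum>(i, j, k, l, a, b, c, d)\<in>UNIV. ?t i a j b k c l d)"
    unfolding local_curvature_norm_sq_def P_def K_def
    by (simp add: sum.cartesian_product mult.assoc)
  have "?r1 = (\<Sum>(l, d, k, c, j, b, i, a)\<in>UNIV.
      P x $ l $ d * (P x $ k $ c * (P x $ j $ b * (P x $ i $ a * (K x i j k l * K x a b c d)))))"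
    unfolding contract_def sum_distrib_left by (simp add: sum.cartesian_product)
  also have "\<dots> = (\<Sum>(i, j, k, l, a, b, c, d)\<in>UNIV. ?t i a j b k c l d)"
    by (rule sum.reindex_bij_witness[where i = "\<lambda>(i, j, k, l, a, b, c, d). (l, d, k, c, j, b, i, a)"
        and j = "\<lambda>(l, d, k, c, j, b, i, a). (i, j, k, l, a, b, c, d)"]) auto
  finally show "local_curvature_norm_sq G x = ?r1" using n by simp
  have "?r2 = (\<Sum>(i, a, j, b, k, c, l, d)\<in>UNIV. ?t i a j b k c l d)"
    unfolding contract_def sum_distrib_left by (simp add: sum.cartesian_product)
  also have "\<dots> = (\<Sum>(i, j, k, l, a, b, c, d)\<in>UNIV. ?t i a j b k c l d)"
    by (rule sum.reindex_bij_witness[where i = "\<lambda>(i, j, k, l, a, b, c, d). (i, a, j, b, k, c, l, d)"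
        and j = "\<lambda>(i, a, j, b, k, c, l, d). (i, j, k, l, a, b, c, d)"]) auto
  finally show "local_curvature_norm_sq G x = ?r2" using n by simp
qed

text \<open>Formally, invert G = J^T H J and multiply by J on the left and by J^T on the
  right.\<close>

lemma matrix_inv_pullback:
  fixes J :: "real ^ 'n ^ 'n"
  assumes J: "invertible J" and H: "invertible H" and G: "transpose J ** H ** J = G"
  shows "J ** matrix_inv G ** transpose J = matrix_inv H"
proof -
  have "invertible G"
    using J H unfolding G[symmetric] by (simp add: invertible_det_nz det_mul det_transpose)
  have "transpose J ** (H ** (J ** matrix_inv G ** transpose J)) = transpose J ** mat 1"
    using matrix_inv_mult(1)[OF \<open>invertible G\<close>]
    by (simp add: matrix_mul_assoc G)
  moreover have "invertible (transpose J)" using J by (simp add: invertible_det_nz det_transpose)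
  ultimately have "H ** (J ** matrix_inv G ** transpose J) = mat 1"
    by (metis matrix_inv_mult(2) matrix_mul_assoc matrix_mul_lid)
  then show ?thesis
    by (metis H matrix_inv_mult(2) matrix_mul_assoc matrix_mul_lid matrix_mul_rid)
qed

lemma (in metric_pullback) local_curvature_norm_sq_pullback:
  assumes x: "x \<in> U"
  shows "local_curvature_norm_sq G x = local_curvature_norm_sq H (\<phi> x)"
proof -
  let ?J = "jacobian \<phi> (at x)"
  have P: "?J ** matrix_inv (G x) ** transpose ?J = matrix_inv (H (\<phi> x))"
    by (rule matrix_inv_pullback[OF invertible_jacobian[OF x] cod.inv[OF maps_to[OF x]] pull[OF x]])
  have "curvature04 G x i j k l = (\<Sum>a\<in>UNIV. ?J $ a $ i * (\<Sum>b\<in>UNIV. ?J $ b $ j *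
    (\<Sum>c\<in>UNIV. ?J $ c $ k * (\<Sum>d\<in>UNIV. ?J $ d $ l * curvature04 H (\<phi> x) a b c d))))" for i j k l
    unfolding jacobian_component[OF x] by (rule curvature04_pullback[OF x])
  then show ?thesis
    \<comment> \<open>On the G side the contraction over i and a is innermost and meets the
      outermost Jacobian sums. Once transformed it is swapped outwards past the others, which
      exposes the pair j, b, and so on. The result has i and a outermost, as in the second
      order.\<close>
    unfolding local_curvature_norm_sq_contract(1)[of G] local_curvature_norm_sq_contract(2)[of H]
    by (simp only: contract_pull[OF P] contract_swap[of "matrix_inv (G x)" "matrix_inv (H (\<phi> x))"])
qed

section \<open>Charts\<close>

lemma chart_onD:
  assumes "chart_on X c"
  shows "openin X (fst c)" "fst c \<subseteq> topspace X" "open (snd c ` fst c)" "inj_on (snd c) (fst c)"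
    "continuous_map (subtopology X (fst c)) euclidean (snd c)"
proof -
  have h: "openin X (fst c)" "open (snd c ` fst c)"
    "homeomorphic_map (subtopology X (fst c)) (top_of_set (snd c ` fst c)) (snd c)"
    using assms by (auto simp: chart_on_def)
  then show "openin X (fst c)" "fst c \<subseteq> topspace X" "open (snd c ` fst c)"
    by (auto dest: openin_subset)
  show "inj_on (snd c) (fst c)"
    using homeomorphic_imp_injective_map[OF h(3)] openin_subset[OF h(1)] by (simp add: Int_absorb1)
  show "continuous_map (subtopology X (fst c)) euclidean (snd c)"
    using homeomorphic_imp_continuous_map[OF h(3)] continuous_map_in_subtopology by blast
qed

lemma chart_inv_eq: "chart_on X c \<Longrightarrow> p \<in> fst c \<Longrightarrow> chart_inv c (snd c p) = p"
  unfolding chart_inv_def using chart_onD(4) by (rule inv_into_f_f)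

lemma chart_eq_inv: "x \<in> snd c ` fst c \<Longrightarrow> snd c (chart_inv c x) = x"
  unfolding chart_inv_def by (rule f_inv_into_f)

lemma chart_inv_mem: "x \<in> snd c ` fst c \<Longrightarrow> chart_inv c x \<in> fst c"
  unfolding chart_inv_def by (rule inv_into_into)

lemma open_chart_image:
  assumes "chart_on X c" "openin X W" "W \<subseteq> fst c"
  shows "open (snd c ` W)"
proof -
  have "homeomorphic_map (subtopology X (fst c)) (top_of_set (snd c ` fst c)) (snd c)"
    using assms(1) by (simp add: chart_on_def)
  moreover have "openin (subtopology X (fst c)) W"
    using assms by (simp add: openin_subset_topspace_eq openin_open_subtopology chart_onD)
  ultimately have "openin (top_of_set (snd c ` fst c)) (snd c ` W)"
    using homeomorphic_imp_open_map open_map_def by blast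
  then show ?thesis using chart_onD(3)[OF assms(1)] by (simp add: openin_open_eq)
qed

lemma openin_chart_preimage:
  assumes "chart_on X c" "open T"
  shows "openin X {p \<in> fst c. snd c p \<in> T}"
proof -
  have "openin (subtopology X (fst c)) {p \<in> topspace (subtopology X (fst c)). snd c p \<in> T}"
    using chart_onD(5)[OF assms(1)] assms(2) by (simp add: continuous_map_def)
  then show ?thesis
    using chart_onD(1,2)[OF assms(1)] by (simp add: openin_open_subtopology Int_absorb1)
qed

lemma continuous_map_chart_inv:
  assumes "chart_on X c"
  shows "continuous_map (top_of_set (snd c ` fst c)) X (chart_inv c)"
  unfolding continuous_map_def
proof (intro conjI allI impI)
  show "chart_inv c \<in> topspace (top_of_set (snd c ` fst c)) \<rightarrow> topspace X"
    using chart_inv_eq[OF assms] chart_onD(2)[OF assms] by auto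
  fix W assume W: "openin X W"
  have "{x \<in> topspace (top_of_set (snd c ` fst c)). chart_inv c x \<in> W} = snd c ` (fst c \<inter> W)"
    using chart_inv_eq[OF assms] by auto
  moreover have "open (snd c ` (fst c \<inter> W))"
    using chart_onD(1)[OF assms] W by (intro open_chart_image[OF assms]) auto
  ultimately show "openin (top_of_set (snd c ` fst c)) {x \<in> topspace (top_of_set (snd c ` fst c)). chart_inv c x \<in> W}"
    by (auto simp: openin_open_eq[OF chart_onD(3)[OF assms]])
qed

lemma coord_rep_eq: "chart_on X c \<Longrightarrow> p \<in> fst c \<Longrightarrow> coord_rep c d f (snd c p) = snd d (f p)"
  by (simp add: coord_rep_def chart_inv_eq)

lemma coord_dom_subset: "coord_dom c d f \<subseteq> snd c ` fst c"
  by (auto simp: coord_dom_def)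

lemma coord_rep_image: "chart_on X c \<Longrightarrow> x \<in> coord_dom c d f \<Longrightarrow> coord_rep c d f x \<in> snd d ` fst d"
  by (auto simp: coord_dom_def coord_rep_eq)

lemma open_coord_dom:
  assumes "chart_on X c" "chart_on X d" "continuous_map X X f"
  shows "open (coord_dom c d f)"
proof -
  have "{p \<in> fst c. f p \<in> fst d} = fst c \<inter> {p \<in> topspace X. f p \<in> fst d}"
    using chart_onD(2)[OF assms(1)] by auto
  then have "openin X {p \<in> fst c. f p \<in> fst d}"
    using assms(3) chart_onD(1)[OF assms(1)] chart_onD(1)[OF assms(2)]
    by (simp add: continuous_map_def openin_Int)
  then show ?thesis unfolding coord_dom_def by (rule open_chart_image[OF assms(1)]) auto
qed

lemma jacobian_eqI:
  fixes M :: "real ^ 'n ^ 'm"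
  shows "(f has_derivative (\<lambda>v. M *v v)) (at x) \<Longrightarrow> jacobian f (at x) = M"
  by (simp add: jacobian_def frechet_derivative_at[symmetric])

lemma invertible_scaleR:
  fixes M :: "real ^ 'n ^ 'n"
  assumes "invertible M" "r \<noteq> 0"
  shows "invertible (r *\<^sub>R M)"
proof -
  have "(r *\<^sub>R M) ** ((1 / r) *\<^sub>R matrix_inv M) = mat 1" "((1 / r) *\<^sub>R matrix_inv M) ** (r *\<^sub>R M) = mat 1"
    using assms(2) matrix_inv_mult[OF assms(1)]
    by (simp_all add: matrix_scalar_ac flip: scalar_matrix_assoc)
  then show ?thesis unfolding invertible_def by blast
qed

lemma scale_metric_1: "scale_metric 1 g = g"
  by (simp add: scale_metric_def)

section \<open>Homotheties of a pseudo-Riemannian manifold\<close>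

locale pr_manifold =
  fixes X :: "'a topology" and A :: "('a, 'n::finite) chart set" and g :: "('a, 'n) tensor2"
  assumes pr_manifold: "pseudo_riemannian_manifold X A g"
begin

lemma chart: "c \<in> A \<Longrightarrow> chart_on X c"
  using pr_manifold
  by (simp add: pseudo_riemannian_manifold_def smooth_manifold_def maximal_smooth_atlas_def)

lemma chart_around: "p \<in> topspace X \<Longrightarrow> \<exists>c\<in>A. p \<in> fst c"
  using pr_manifold
  unfolding pseudo_riemannian_manifold_def smooth_manifold_def maximal_smooth_atlas_def by blast

lemma compatible: "c \<in> A \<Longrightarrow> d \<in> A \<Longrightarrow> smoothly_compatible c d"
  using pr_manifold
  by (simp add: pseudo_riemannian_manifold_def smooth_manifold_def maximal_smooth_atlas_def)

lemma maximal: "chart_on X c \<Longrightarrow> (\<And>d. d \<in> A \<Longrightarrow> smoothly_compatible c d) \<Longrightarrow> c \<in> A"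
  using pr_manifold
  unfolding pseudo_riemannian_manifold_def smooth_manifold_def maximal_smooth_atlas_def by blast

lemma connected: "connected_space X"
  using pr_manifold by (simp add: pseudo_riemannian_manifold_def smooth_manifold_def)

lemma in_topspace: "c \<in> A \<Longrightarrow> p \<in> fst c \<Longrightarrow> p \<in> topspace X"
  using chart chart_onD(2) by blast

lemma smooth_map_id: "smooth_map X A (\<lambda>p. p)"
  using compatible by (auto simp: smooth_map_def smoothly_compatible_def)

lemma pulls_back_id: "pulls_back_to A (\<lambda>p. p) g g"
  using pr_manifold by (simp add: pseudo_riemannian_manifold_def pseudo_riemannian_metric_def)

lemma local_metric_chart: "c \<in> A \<Longrightarrow> local_metric (snd c ` fst c) (g c)"
  using pr_manifold chart chart_onD(3)
  unfolding pseudo_riemannian_manifold_def pseudo_riemannian_metric_def local_metric_def by blast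

lemma smooth_mapD:
  assumes "smooth_map X A f" "c \<in> A" "d \<in> A"
  shows "open (coord_dom c d f)" "smooth_on (coord_dom c d f) (coord_rep c d f)"
  using assms open_coord_dom chart unfolding smooth_map_def by blast+

lemma smooth_map_topspace: "smooth_map X A f \<Longrightarrow> p \<in> topspace X \<Longrightarrow> f p \<in> topspace X"
  by (auto simp: smooth_map_def continuous_map_def)

lemma coord_rep_has_jacobian:
  assumes "smooth_map X A f" "c \<in> A" "d \<in> A" "p \<in> fst c" "f p \<in> fst d"
  shows "(coord_rep c d f has_derivative (\<lambda>v. jacobian (coord_rep c d f) (at (snd c p)) *v v)) (at (snd c p))"
proof -
  have "snd c p \<in> coord_dom c d f" using assms by (auto simp: coord_dom_def)
  then show ?thesis
    using smooth_on_differentiable[OF smooth_mapD(2)[OF assms(1-3)]] jacobian_works by blast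
qed

lemma pulls_back_toD:
  assumes "pulls_back_to A f g (scale_metric r g)" "c \<in> A" "d \<in> A" "p \<in> fst c" "f p \<in> fst d"
  shows "transpose (jacobian (coord_rep c d f) (at (snd c p))) ** g d (snd d (f p))
    ** jacobian (coord_rep c d f) (at (snd c p)) = r *\<^sub>R g c (snd c p)"
  using assms unfolding pulls_back_to_def scale_metric_def Let_def by blast

text \<open>A homothety is an isometry from the rescaled metric r g. Naturality is applied with r g
  on the source, and \<open>local_curvature_norm_sq_scaleR\<close> then extracts the scale.\<close>

lemma local_curvature_norm_sq_pulled_back:
  assumes f: "smooth_map X A f" and pb: "pulls_back_to A f g (scale_metric r g)" and r: "r \<noteq> 0"
    and c: "c \<in> A" and d: "d \<in> A" and p: "p \<in> fst c" "f p \<in> fst d"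
  shows "local_curvature_norm_sq (g d) (snd d (f p)) = local_curvature_norm_sq (g c) (snd c p) / r\<^sup>2"
proof -
  let ?U = "coord_dom c d f" and ?\<phi> = "coord_rep c d f"
  interpret c: local_metric "snd c ` fst c" "g c" by (rule local_metric_chart[OF c])
  interpret d: local_metric "snd d ` fst d" "g d" by (rule local_metric_chart[OF d])
  note sub = subsetD[OF coord_dom_subset[of c d f]]
  interpret metric_pullback ?U "\<lambda>y. r *\<^sub>R g c y" "snd d ` fst d" "g d" ?\<phi>
  proof
    show "open ?U" "smooth_on ?U ?\<phi>" using smooth_mapD[OF f c d] by auto
    then show "smooth_on ?U (\<lambda>y. r *\<^sub>R g c y)"
      using smooth_on_subset[OF c.smooth_metric coord_dom_subset]
      by (intro smooth_on_scaleR smooth_on_const) auto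
    show "transpose (r *\<^sub>R g c y) = r *\<^sub>R g c y" if "y \<in> ?U" for y
      using c.sym[OF sub[OF that]] by (simp add: transpose_def vec_eq_iff)
    show "invertible (r *\<^sub>R g c y)" if "y \<in> ?U" for y
      using c.inv[OF sub[OF that]] r by (rule invertible_scaleR)
    show "?\<phi> x \<in> snd d ` fst d" if "x \<in> ?U" for x
      using that by (rule coord_rep_image[OF chart[OF c]])
    show "transpose (jacobian ?\<phi> (at x)) ** g d (?\<phi> x) ** jacobian ?\<phi> (at x) = r *\<^sub>R g c x"
      if x: "x \<in> ?U" for x
    proof -
      obtain q where q: "x = snd c q" "q \<in> fst c" "f q \<in> fst d" using x unfolding coord_dom_def by blast
      show ?thesis
        using pulls_back_toD[OF pb c d q(2,3)] coord_rep_eq[OF chart[OF c] q(2)] q(1) by simp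
    qed
  qed
  have p': "snd c p \<in> ?U" using p by (auto simp: coord_dom_def)
  have "local_curvature_norm_sq (g d) (snd d (f p)) = local_curvature_norm_sq (\<lambda>y. r *\<^sub>R g c y) (snd c p)"
    using local_curvature_norm_sq_pullback[OF p'] coord_rep_eq[OF chart[OF c] p(1), of d f] by simp
  also have "\<dots> = local_curvature_norm_sq (g c) (snd c p) / r\<^sup>2"
    using p(1) by (intro local_curvature_norm_sq_scaleR[OF c.open_dom _ c.inv smooth_on_differentiable[OF c.smooth_metric] r]) auto
  finally show ?thesis .
qed

text \<open>The chosen chart and c are related by the identity map, which pulls g back to itself:
  the case r = 1 of \<open>local_curvature_norm_sq_pulled_back\<close>.\<close>

lemma curvature_norm_sq_chart:
  assumes "c \<in> A" "p \<in> fst c"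
  shows "curvature_norm_sq A g p = local_curvature_norm_sq (g c) (snd c p)"
proof -
  let ?d = "SOME c. c \<in> A \<and> p \<in> fst c"
  have d: "?d \<in> A \<and> p \<in> fst ?d" by (rule someI[of _ c]) (use assms in simp)
  then have "local_curvature_norm_sq (g ?d) (snd ?d p) = local_curvature_norm_sq (g c) (snd c p) / 1\<^sup>2"
    using assms pulls_back_id
    by (intro local_curvature_norm_sq_pulled_back[OF smooth_map_id]) (auto simp: scale_metric_1)
  then show ?thesis by (simp add: curvature_norm_sq_def Let_def)
qed

lemma curvature_norm_sq_pulled_back:
  assumes f: "smooth_map X A f" and pb: "pulls_back_to A f g (scale_metric r g)" and r: "r \<noteq> 0"
    and p: "p \<in> topspace X"
  shows "curvature_norm_sq A g (f p) = curvature_norm_sq A g p / r\<^sup>2"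
proof -
  obtain c d where "c \<in> A" "p \<in> fst c" "d \<in> A" "f p \<in> fst d"
    using chart_around[OF p] chart_around[OF smooth_map_topspace[OF f p]] by blast
  then show ?thesis using local_curvature_norm_sq_pulled_back[OF f pb r] curvature_norm_sq_chart by simp
qed

lemma pulls_back_compose:
  assumes f: "smooth_map X A f" "pulls_back_to A f g (scale_metric r g)"
    and h: "smooth_map X A h" "pulls_back_to A h g (scale_metric s g)"
  shows "pulls_back_to A (f \<circ> h) g (scale_metric (r * s) g)"
  unfolding pulls_back_to_def Let_def
proof (intro ballI impI)
  fix c e p assume c: "c \<in> A" and e: "e \<in> A" and p: "p \<in> fst c" "(f \<circ> h) p \<in> fst e"
  obtain d where d: "d \<in> A" "h p \<in> fst d"
    using chart_around[OF smooth_map_topspace[OF h(1) in_topspace[OF c p(1)]]] by blast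
  let ?J = "jacobian (coord_rep c d h) (at (snd c p))" and ?K = "jacobian (coord_rep d e f) (at (snd d (h p)))"
  have "(coord_rep d e f has_derivative (\<lambda>v. ?K *v v)) (at (coord_rep c d h (snd c p)))"
    using coord_rep_has_jacobian[OF f(1) d(1) e d(2)] p by (simp add: coord_rep_eq[OF chart[OF c]])
  from diff_chain_at[OF coord_rep_has_jacobian[OF h(1) c d(1) p(1) d(2)] this]
  have "(coord_rep d e f \<circ> coord_rep c d h has_derivative (\<lambda>v. (?K ** ?J) *v v)) (at (snd c p))"
    by (simp add: o_def matrix_vector_mul_assoc)
  moreover have "snd c p \<in> coord_dom c d h" using p d by (auto simp: coord_dom_def)
  \<comment> \<open>The two maps are compared only where h lands in the domain of d. This is an open
    neighbourhood of the point, which is all the derivative sees.\<close>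
  moreover have "(coord_rep d e f \<circ> coord_rep c d h) x = coord_rep c e (f \<circ> h) x" if "x \<in> coord_dom c d h" for x
    using that by (auto simp: coord_dom_def coord_rep_def chart_inv_eq[OF chart[OF c]] chart_inv_eq[OF chart[OF d(1)]])
  ultimately have "(coord_rep c e (f \<circ> h) has_derivative (\<lambda>v. (?K ** ?J) *v v)) (at (snd c p))"
    using has_derivative_transform_within_open[OF _ smooth_mapD(1)[OF h(1) c d(1)]] by blast
  from jacobian_eqI[OF this]
  have "jacobian (coord_rep c e (f \<circ> h)) (at (snd c p)) = ?K ** ?J" .
  moreover have "transpose (?K ** ?J) ** M ** (?K ** ?J) = transpose ?J ** (transpose ?K ** M ** ?K) ** ?J" for M
    by (simp add: matrix_transpose_mul matrix_mul_assoc)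
  moreover have "transpose ?K ** g e (snd e (f (h p))) ** ?K = r *\<^sub>R g d (snd d (h p))"
    using pulls_back_toD[OF f(2) d(1) e d(2)] p by simp
  moreover have "transpose ?J ** g d (snd d (h p)) ** ?J = s *\<^sub>R g c (snd c p)"
    by (rule pulls_back_toD[OF h(2) c d(1) p(1) d(2)])
  ultimately show "transpose (jacobian (coord_rep c e (f \<circ> h)) (at (snd c p))) ** g e (snd e ((f \<circ> h) p))
      ** jacobian (coord_rep c e (f \<circ> h)) (at (snd c p)) = scale_metric (r * s) g c (snd c p)"
    by (simp add: scale_metric_def matrix_scalar_ac flip: scalar_matrix_assoc)
qed

text \<open>At one point g is an invertible and hence nonzero matrix, so r g = s g gives r = s. This
  makes the definite description in \<open>homothety_factor\<close> well defined.\<close>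

lemma scale_unique:
  assumes f: "f \<in> topspace X \<rightarrow> topspace X" and "pulls_back_to A f g (scale_metric r g)" "pulls_back_to A f g (scale_metric s g)"
    and "topspace X \<noteq> {}"
  shows "r = s"
proof -
  obtain p where p: "p \<in> topspace X" using assms(4) by blast
  obtain c d where c: "c \<in> A" "p \<in> fst c" "d \<in> A" "f p \<in> fst d"
    using chart_around[OF p] chart_around[OF funcset_mem[OF f p]] by blast
  interpret local_metric "snd c ` fst c" "g c" by (rule local_metric_chart[OF c(1)])
  have "invertible (g c (snd c p))" using c by (intro inv) auto
  then have "g c (snd c p) \<noteq> 0"
    by (metis det_0 invertible_det_nz mat_0)
  moreover have "r *\<^sub>R g c (snd c p) = s *\<^sub>R g c (snd c p)"
    using pulls_back_toD[OF assms(2) c(1,3,2,4)] pulls_back_toD[OF assms(3) c(1,3,2,4)] by metis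
  ultimately show ?thesis by (metis scaleR_cancel_right)
qed

lemma homothety_factor_eqI:
  assumes f: "f \<in> topspace X \<rightarrow> topspace X" and l: "l > 0" "pulls_back_to A f g (scale_metric (l\<^sup>2) g)" and "topspace X \<noteq> {}"
  shows "homothety_factor A g f = l"
  unfolding homothety_factor_def
proof (rule the_equality)
  fix k assume k: "k > 0 \<and> pulls_back_to A f g (scale_metric (k\<^sup>2) g)"
  then have "k\<^sup>2 = l\<^sup>2" using scale_unique[OF f _ l(2) assms(4)] by blast
  then show "k = l" using k l(1) by (simp add: power2_eq_iff_nonneg)
qed (use l in simp)

lemma homothetyD:
  assumes "homothety X A g f" "topspace X \<noteq> {}"
  shows "smooth_map X A f" "homothety_factor A g f > 0"
    "pulls_back_to A f g (scale_metric ((homothety_factor A g f)\<^sup>2) g)"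
proof -
  show f: "smooth_map X A f" using assms by (simp add: homothety_def diffeomorphism_def)
  obtain l where l: "l \<noteq> 0" "pulls_back_to A f g (scale_metric (l\<^sup>2) g)"
    using assms by (auto simp: homothety_def)
  \<comment> \<open>The definition of a homothety admits negative l; the absolute value has the same
    square and is the factor.\<close>
  then have "\<bar>l\<bar> > 0" "pulls_back_to A f g (scale_metric (\<bar>l\<bar>\<^sup>2) g)" by auto
  with homothety_factor_eqI[OF _ this assms(2)] smooth_map_topspace[OF f]
  show "homothety_factor A g f > 0" "pulls_back_to A f g (scale_metric ((homothety_factor A g f)\<^sup>2) g)"
    by simp_all
qed

lemma homothety_factor_compose:
  assumes "homothety X A g f" "homothety X A g h" "topspace X \<noteq> {}"
  shows "homothety_factor A g (f \<circ> h) = homothety_factor A g f * homothety_factor A g h"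
proof -
  note f = homothetyD[OF assms(1,3)] and h = homothetyD[OF assms(2,3)]
  let ?l = "homothety_factor A g f * homothety_factor A g h"
  have pb: "pulls_back_to A (f \<circ> h) g (scale_metric (?l\<^sup>2) g)"
    using pulls_back_compose[OF f(1,3) h(1,3)] by (simp add: power_mult_distrib)
  have "f \<circ> h \<in> topspace X \<rightarrow> topspace X" "?l > 0"
    using smooth_map_topspace f(1,2) h(1,2) by auto
  then show ?thesis by (rule homothety_factor_eqI[OF _ _ pb assms(3)])
qed

lemma homothety_curvature_norm_sq:
  assumes "homothety X A g f" "p \<in> topspace X"
  shows "curvature_norm_sq A g (f p) = curvature_norm_sq A g p / homothety_factor A g f ^ 4"
proof -
  have ne: "topspace X \<noteq> {}" using assms(2) by blast
  note f = homothetyD[OF assms(1) ne]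
  show ?thesis
    using curvature_norm_sq_pulled_back[OF f(1,3) _ assms(2)] f(2) by simp
qed

end

section \<open>Straightening a function without critical points\<close>

text \<open>Some partial derivative of f is nonzero at x0. Replacing that coordinate by f - f x0
  gives a map with invertible derivative, which the inverse function theorem turns into a local
  change of coordinates.\<close>

lemma smooth_straightening:
  fixes f :: "real ^ 'n::finite \<Rightarrow> real"
  assumes V: "open V" and f: "smooth_on V f" and x0: "x0 \<in> V" and nz: "dir_deriv u f x0 \<noteq> 0"
  obtains i and a b :: "real ^ 'n" and U F G where "open U" "U \<subseteq> V" "x0 \<in> U" "homeomorphism U (box a b) F G"
    "smooth_on U F" "smooth_on (box a b) G" "\<And>x. x \<in> U \<Longrightarrow> F x $ i = f x - f x0"
proof -
  obtain i where i: "dir_deriv (axis i 1) f x0 \<noteq> 0"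
    using nz dir_deriv_expand[OF f x0, of u] by (metis (no_types, lifting) scaleR_zero_right sum.neutral)
  let ?e = "axis i 1 :: real ^ 'n"
  have Df: "smooth_on V (dir_deriv v f)" for v by (rule smooth_on_dir_deriv[OF f])
  \<comment> \<open>The inverse derivative \<open>N\<close> below divides by the i-th partial
    derivative of f, so the domain is cut down to where this stays nonzero. Smoothness of
    \<open>G\<close> needs \<open>N\<close> at all nearby points and not only at x0.\<close>
  define V1 where "V1 = {x \<in> V. dir_deriv ?e f x \<noteq> 0}"
  have "continuous_on V (dir_deriv ?e f)" using smooth_onD[OF Df, of 0] by simp
  then have "open (V \<inter> dir_deriv ?e f -` (- {0}))"
    using continuous_open_preimage[OF _ V, of "dir_deriv ?e f" "- {0}"] by auto
  also have "V \<inter> dir_deriv ?e f -` (- {0}) = V1" by (auto simp: V1_def)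
  finally have V1: "open V1" .
  have V1_V: "V1 \<subseteq> V" by (auto simp: V1_def)
  have x0': "x0 \<in> V1" using x0 i by (simp add: V1_def)
  define F where "F x = x + (f x - f x0 - x $ i) *\<^sub>R ?e" for x
  have F: "smooth_on V F"
    unfolding F_def
    by (intro smooth_on_add smooth_on_id smooth_on_scaleR smooth_on_diff smooth_on_const smooth_on_vec_nth V f)
  have DF: "dir_deriv v F x = v + (dir_deriv v f x - v $ i) *\<^sub>R ?e" if "x \<in> V" for v x
  proof (rule dir_deriv_eqI)
    show "(F has_derivative (\<lambda>v. v + (dir_deriv v f x - v $ i) *\<^sub>R ?e)) (at x)"
      unfolding F_def using has_derivative_dir_deriv[OF f that]
      by (auto intro!: derivative_eq_intros bounded_linear.has_derivative[OF bounded_linear_vec_nth])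
  qed
  \<comment> \<open>\<open>N x\<close> is the inverse of the derivative of \<open>F\<close> at \<open>x\<close>.\<close>
  define N where "N x v = v + ((v $ i - dir_deriv v f x) / dir_deriv ?e f x) *\<^sub>R ?e" for x v
  have DFN: "dir_deriv (N x v) F x = v" and NDF: "N x (dir_deriv v F x) = v" if "x \<in> V1" for x v
  proof -
    have x: "x \<in> V" and nz: "dir_deriv ?e f x \<noteq> 0" using that by (auto simp: V1_def)
    show "dir_deriv (N x v) F x = v"
      using nz by (simp add: DF[OF x] N_def dir_deriv_add_dir[OF f x] dir_deriv_scaleR_dir[OF f x])
    show "N x (dir_deriv v F x) = v"
      using nz by (simp add: DF[OF x] N_def dir_deriv_add_dir[OF f x] dir_deriv_scaleR_dir[OF f x]
          flip: scaleR_add_left)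
  qed
  \<comment> \<open>The inverse function theorem takes the derivative as a continuous map into the
    space of bounded linear operators.\<close>
  define F' where "F' x = Blinfun (\<lambda>v. dir_deriv v F x)" for x
  have F'_apply: "blinfun_apply (F' x) = (\<lambda>v. dir_deriv v F x)" if "x \<in> V" for x
    unfolding F'_def using has_derivative_dir_deriv[OF F that]
    by (intro bounded_linear_Blinfun_apply has_derivative_bounded_linear)
  have "bounded_linear (N x0)"
  proof (rule linear_conv_bounded_linear[THEN iffD1], rule linearI)
    show "N x0 (v + w) = N x0 v + N x0 w" for v w
      by (simp add: N_def dir_deriv_add_dir[OF f x0] add_divide_distrib diff_divide_distrib algebra_simps)
    show "N x0 (r *\<^sub>R v) = r *\<^sub>R N x0 v" for r v
      by (simp add: N_def dir_deriv_scaleR_dir[OF f x0] scaleR_add_right right_diff_distrib diff_divide_distrib)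
  qed
  then have N0: "Blinfun (N x0) o\<^sub>L F' x0 = id_blinfun"
    by (intro blinfun_eqI) (simp add: bounded_linear_Blinfun_apply F'_apply[OF x0] NDF[OF x0'])
  have der: "(F has_derivative blinfun_apply (F' x)) (at x)" if "x \<in> V1" for x
    using has_derivative_dir_deriv[OF F, of x] F'_apply[of x] V1_V that by auto
  have cont: "continuous_on V1 F'"
  proof (rule continuous_on_blinfun_componentwise)
    fix j :: "real ^ 'n"
    have "continuous_on V1 (dir_deriv j F)"
      using smooth_onD[OF smooth_on_dir_deriv[OF F], of 0] by (auto intro: continuous_on_subset[OF _ V1_V])
    then show "continuous_on V1 (\<lambda>x. blinfun_apply (F' x) j)"
      using F'_apply V1_V by (auto cong: continuous_on_cong simp: subset_iff)
  qed
  obtain U' W G g' where U': "open U'" "U' \<subseteq> V1" "x0 \<in> U'" and W: "open W" "F x0 \<in> W"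
    and hom: "homeomorphism U' W F G"
    and G': "\<And>y. y \<in> W \<Longrightarrow> (G has_derivative g' y) (at y)"
      "\<And>y. y \<in> W \<Longrightarrow> g' y = inv (blinfun_apply (F' (G y)))"
      "\<And>y. y \<in> W \<Longrightarrow> bij (blinfun_apply (F' (G y)))"
    using inverse_function_theorem[OF V1 der cont x0' N0] by blast
  have GU: "G y \<in> V1" if "y \<in> W" for y
    using hom U'(2) that by (auto simp: homeomorphism_def)
  have g'N: "(G has_derivative N (G y)) (at y)" if "y \<in> W" for y
  proof -
    have y: "G y \<in> V" using GU[OF that] V1_V by blast
    have "g' y v = N (G y) v" for v
      unfolding G'(2)[OF that]
      by (rule inv_f_eq[OF bij_is_inj[OF G'(3)[OF that]]]) (simp add: F'_apply[OF y] DFN[OF GU[OF that]])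
    then have "g' y = N (G y)" by (rule ext)
    then show ?thesis using G'(1)[OF that] by simp
  qed
  \<comment> \<open>Bootstrapping: DG(y) = N(G y) involves only derivatives of f at G y. If G is of
    order k, then so is DG, and G is of order k + 1.\<close>
  have "Ck_on k W G" for k
  proof (induction k)
    case 0
    then show ?case using hom by (simp add: homeomorphism_def)
  next
    case (Suc k)
    have D: "Ck_on k W (\<lambda>y. dir_deriv v f (G y))" for v
      using GU by (intro Ck_on_compose[OF W(1) V1 _ Suc] Ck_on_subset[OF _ V1_V] smooth_onD[OF Df]) auto
    show ?case
      using GU unfolding V1_def
      by (intro Ck_on_SucI[OF W(1) g'N])
        (auto simp: N_def intro!: Ck_on_add Ck_on_const Ck_on_scaleR Ck_on_divide Ck_on_diff D W(1))
  qed
  then have G: "smooth_on W G" by (rule smooth_onI)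
  \<comment> \<open>Foliation charts have boxes as images, so the target is shrunk to a box around F
    x0.\<close>
  obtain a b where ab: "F x0 \<in> box a b" "box a b \<subseteq> W"
    using open_contains_box[OF W(1,2)] by metis
  define U where "U = G ` box a b"
  have FG: "F ` U' = W" "G ` W = U'" "\<And>x. x \<in> U' \<Longrightarrow> G (F x) = x" "\<And>y. y \<in> W \<Longrightarrow> F (G y) = y"
    using hom by (auto simp: homeomorphism_def)
  have UG: "U = U' \<inter> F -` box a b"
  proof
    show "U \<subseteq> U' \<inter> F -` box a b"
      using FG(2,4) ab(2) unfolding U_def by auto
    show "U' \<inter> F -` box a b \<subseteq> U"
      using FG(3) unfolding U_def by (metis IntE image_eqI subsetI vimageE)
  qed
  have "continuous_on U' F" using hom by (simp add: homeomorphism_def)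
  then have U: "open U" unfolding UG by (rule continuous_open_preimage[OF _ U'(1) open_box])
  have "homeomorphism U (box a b) F G"
  proof (rule homeomorphism_of_subsets[OF hom])
    show "U \<subseteq> U'" using UG by blast
    show "box a b \<subseteq> W" by (rule ab(2))
    have "F ` G ` box a b = (\<lambda>y. y) ` box a b"
      unfolding image_image using FG(4) ab(2) by (intro image_cong) auto
    then show "F ` U = box a b" by (simp add: U_def)
  qed
  moreover have "U \<subseteq> V" "x0 \<in> U" using UG U' V1_V ab(1) by auto
  ultimately show thesis
  proof (rule_tac that[of U a b F G i])
    show "smooth_on U F" using smooth_on_subset[OF F \<open>U \<subseteq> V\<close>] .
    show "smooth_on (box a b) G" using smooth_on_subset[OF G ab(2)] .
    show "F x $ i = f x - f x0" for x by (simp add: F_def)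
  qed (use U in auto)
qed

section \<open>Adapted charts, and functions with vanishing differential\<close>

context pr_manifold
begin

lemma coord_differential_dir_deriv:
  "coord_differential c f p = (\<lambda>v. dir_deriv v (f \<circ> chart_inv c) (snd c p))"
  by (simp add: coord_differential_def dir_deriv_def)

text \<open>Membership comes from maximality of the atlas: a transition between the new chart and
  any e is a transition between c and e composed with F or G.\<close>

lemma restricted_chart_mem_atlas:
  assumes c: "c \<in> A" and U: "U \<subseteq> snd c ` fst c" "open U"
    and hom: "homeomorphism U W F G" and W: "open W" and smooth: "smooth_on U F" "smooth_on W G"
  shows "(chart_inv c ` U, F \<circ> snd c) \<in> A"
proof -
  let ?d = "(chart_inv c ` U, F \<circ> snd c)"
  note ch = chart[OF c]
  have FG: "F ` U = W" "G ` W = U" "\<And>x. x \<in> U \<Longrightarrow> G (F x) = x" "\<And>y. y \<in> W \<Longrightarrow> F (G y) = y"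
    "continuous_on U F" "continuous_on W G"
    using hom by (auto simp: homeomorphism_def)
  have dom: "chart_inv c ` U = {p \<in> fst c. snd c p \<in> U}"
    using U(1) chart_inv_eq[OF ch] chart_eq_inv[of _ c] chart_inv_mem[of _ c] by (force simp: image_iff)
  have snd_c: "snd c (chart_inv c x) = x" if "x \<in> U" for x using that U(1) by (intro chart_eq_inv) auto
  have img: "snd ?d ` fst ?d = W"
    using FG(1) snd_c by (auto simp: image_image)
  have d: "chart_on X ?d"
    unfolding chart_on_def img
  proof (intro conjI)
    show "openin X (fst ?d)" unfolding fst_conv dom by (rule openin_chart_preimage[OF ch U(2)])
    show "open W" by (rule W)
    have "continuous_map (subtopology X (chart_inv c ` U)) (top_of_set U) (snd c)"
      unfolding dom using chart_onD(5)[OF ch]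
      by (auto simp: continuous_map_in_subtopology intro: continuous_map_from_subtopology_mono)
    moreover have "continuous_map (top_of_set U) (top_of_set W) F"
      using FG by auto
    ultimately have 1: "continuous_map (subtopology X (chart_inv c ` U)) (top_of_set W) (F \<circ> snd c)"
      by (rule continuous_map_compose)
    have "continuous_map (top_of_set W) (top_of_set (snd c ` fst c)) G"
      using FG U(1) by auto
    from continuous_map_compose[OF this continuous_map_chart_inv[OF ch]]
    have 2: "continuous_map (top_of_set W) (subtopology X (chart_inv c ` U)) (chart_inv c \<circ> G)"
      using FG(2) by (auto simp: continuous_map_in_subtopology)
    have "homeomorphic_maps (subtopology X (chart_inv c ` U)) (top_of_set W) (F \<circ> snd c) (chart_inv c \<circ> G)"
      using 1 2 FG snd_c by (auto simp: homeomorphic_maps_def)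
    then show "homeomorphic_map (subtopology X (fst ?d)) (top_of_set W) (snd ?d)"
      by (auto intro: homeomorphic_maps_imp_map)
  qed
  have id: "continuous_map X X (\<lambda>p. p)" by simp
  have inv_d: "chart_inv ?d y = chart_inv c (G y)" if "y \<in> W" for y
  proof -
    have "chart_inv c (G y) \<in> fst ?d" "snd ?d (chart_inv c (G y)) = y"
      using that FG snd_c by auto
    then show ?thesis using chart_inv_eq[OF d] by metis
  qed
  show ?thesis
  proof (rule maximal[OF d])
    fix e assume e: "e \<in> A"
    show "smoothly_compatible ?d e"
      unfolding smoothly_compatible_def
    proof
      have eq: "coord_rep ?d e (\<lambda>p. p) y = coord_rep c e (\<lambda>p. p) (G y)" if "y \<in> coord_dom ?d e (\<lambda>p. p)" for y
        using that inv_d coord_dom_subset[of ?d e "\<lambda>p. p"] img by (auto simp: coord_rep_def)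
      have "smooth_on (coord_dom ?d e (\<lambda>p. p)) (\<lambda>y. coord_rep c e (\<lambda>p. p) (G y))"
      proof (rule smooth_on_compose[where f = G and h = "coord_rep c e (\<lambda>p. p)", OF open_coord_dom[OF d chart[OF e] id] smooth_mapD(1)[OF smooth_map_id c e]])
        show "smooth_on (coord_dom ?d e (\<lambda>p. p)) G"
          using smooth(2) coord_dom_subset[of ?d e "\<lambda>p. p"] img by (auto intro: smooth_on_subset)
        show "smooth_on (coord_dom c e (\<lambda>p. p)) (coord_rep c e (\<lambda>p. p))"
          by (rule smooth_mapD(2)[OF smooth_map_id c e])
        show "G ` coord_dom ?d e (\<lambda>p. p) \<subseteq> coord_dom c e (\<lambda>p. p)"
        proof
          fix z assume "z \<in> G ` coord_dom ?d e (\<lambda>p. p)"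
          then obtain p where p: "p \<in> fst ?d" "p \<in> fst e" "z = G (F (snd c p))"
            unfolding coord_dom_def by force
          then have "p \<in> fst c" "snd c p \<in> U" unfolding fst_conv dom by auto
          then show "z \<in> coord_dom c e (\<lambda>p. p)" using p FG(3) unfolding coord_dom_def by auto
        qed
      qed
      then show "smooth_on (coord_dom ?d e (\<lambda>p. p)) (coord_rep ?d e (\<lambda>p. p))"
        by (rule iffD2[OF smooth_on_cong[where h = "\<lambda>y. coord_rep c e (\<lambda>p. p) (G y)",
              OF open_coord_dom[OF d chart[OF e] id]], rotated]) (rule eq)
      have "coord_rep e ?d (\<lambda>p. p) x = F (coord_rep e c (\<lambda>p. p) x)" for x
        by (simp add: coord_rep_def)
      moreover have "smooth_on (coord_dom e ?d (\<lambda>p. p)) (\<lambda>x. F (coord_rep e c (\<lambda>p. p) x))"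
      proof (rule smooth_on_compose[where f = "coord_rep e c (\<lambda>p. p)" and h = F, OF open_coord_dom[OF chart[OF e] d id] U(2) _ _ smooth(1)])
        show "smooth_on (coord_dom e ?d (\<lambda>p. p)) (coord_rep e c (\<lambda>p. p))"
          by (rule smooth_on_subset[OF smooth_mapD(2)[OF smooth_map_id e c]])
            (use dom in \<open>auto simp: coord_dom_def\<close>)
        show "coord_rep e c (\<lambda>p. p) ` coord_dom e ?d (\<lambda>p. p) \<subseteq> U"
        proof
          fix z assume "z \<in> coord_rep e c (\<lambda>p. p) ` coord_dom e ?d (\<lambda>p. p)"
          then obtain p where p: "p \<in> fst e" "p \<in> fst ?d" "z = snd c p"
            unfolding coord_dom_def by (force simp: coord_rep_eq[OF chart[OF e]])
          then show "z \<in> U" unfolding fst_conv dom by simp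
        qed
      qed
      ultimately show "smooth_on (coord_dom e ?d (\<lambda>p. p)) (coord_rep e ?d (\<lambda>p. p))"
        by presburger
    qed
  qed
qed

lemma flow_box:
  assumes f: "smooth_fun A f" and c: "c \<in> A" and p: "p \<in> fst c" and nz: "coord_differential c f p \<noteq> (\<lambda>v. 0)"
  obtains d i a b where "d \<in> A" "p \<in> fst d" "snd d ` fst d = box a b"
    "\<And>q. q \<in> fst d \<Longrightarrow> snd d q $ i = f q - f p"
proof -
  note ch = chart[OF c]
  obtain u where u: "dir_deriv u (f \<circ> chart_inv c) (snd c p) \<noteq> 0"
    using nz unfolding coord_differential_dir_deriv by blast
  have sm: "smooth_on (snd c ` fst c) (f \<circ> chart_inv c)" using f c by (simp add: smooth_fun_def)
  show thesis
  proof (rule smooth_straightening[OF chart_onD(3)[OF ch] sm imageI[OF p] u])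
    fix i and a b :: "real ^ 'n" and U F G
    assume U: "open U" "U \<subseteq> snd c ` fst c" "snd c p \<in> U"
      and hom: "homeomorphism U (box a b) F G" and smooth: "smooth_on U F" "smooth_on (box a b) G"
      and Fi: "\<And>x. x \<in> U \<Longrightarrow> F x $ i = (f \<circ> chart_inv c) x - (f \<circ> chart_inv c) (snd c p)"
    have snd_c: "snd c (chart_inv c x) = x" if "x \<in> U" for x using that U(2) by (intro chart_eq_inv) auto
    show thesis
    proof (rule that[of "(chart_inv c ` U, F \<circ> snd c)" a b i])
      show "(chart_inv c ` U, F \<circ> snd c) \<in> A"
        by (rule restricted_chart_mem_atlas[OF c U(2,1) hom open_box smooth])
      show "p \<in> fst (chart_inv c ` U, F \<circ> snd c)"
        using U(3) chart_inv_eq[OF ch p] by force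
      show "snd (chart_inv c ` U, F \<circ> snd c) ` fst (chart_inv c ` U, F \<circ> snd c) = box a b"
        using hom snd_c by (auto simp: image_image homeomorphism_def)
      show "snd (chart_inv c ` U, F \<circ> snd c) q $ i = f q - f p" if "q \<in> fst (chart_inv c ` U, F \<circ> snd c)" for q
        using that snd_c Fi chart_inv_eq[OF ch p] by auto
    qed
  qed
qed

text \<open>A coordinate ball is convex, so a zero derivative makes f constant on it. Thus f is
  locally constant, the set where it equals f p is open and closed, and connectedness of X
  finishes.\<close>

lemma smooth_fun_constant:
  assumes f: "smooth_fun A f"
    and zero: "\<And>c p. c \<in> A \<Longrightarrow> p \<in> fst c \<Longrightarrow> coord_differential c f p = (\<lambda>v. 0)"
    and pq: "p \<in> topspace X" "q \<in> topspace X"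
  shows "f p = f q"
proof -
  have loc: "\<exists>W. openin X W \<and> r \<in> W \<and> (\<forall>s\<in>W. f s = f r)" if r: "r \<in> topspace X" for r
  proof -
    obtain c where c: "c \<in> A" "r \<in> fst c" using chart_around[OF r] by blast
    note ch = chart[OF c(1)]
    obtain e where e: "e > 0" "ball (snd c r) e \<subseteq> snd c ` fst c"
      using chart_onD(3)[OF ch] c(2) openE by blast
    let ?h = "f \<circ> chart_inv c"
    have "(?h has_derivative (\<lambda>v. 0)) (at x)" if "x \<in> snd c ` fst c" for x
    proof -
      have "(?h has_derivative frechet_derivative ?h (at x)) (at x)"
        using f c(1) that smooth_on_has_derivative unfolding smooth_fun_def by blast
      then show ?thesis using zero[OF c(1)] that by (auto simp: coord_differential_def)
    qed
    then have "(?h has_derivative (\<lambda>v. 0)) (at x within ball (snd c r) e)" if "x \<in> ball (snd c r) e" for x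
      using e(2) that has_derivative_at_withinI by blast
    from has_derivative_zero_constant[OF convex_ball this]
    obtain k where k: "\<And>x. x \<in> ball (snd c r) e \<Longrightarrow> ?h x = k" by blast
    have "f s = k" if "s \<in> fst c" "snd c s \<in> ball (snd c r) e" for s
      using k[OF that(2)] chart_inv_eq[OF ch that(1)] by simp
    moreover have "f r = k" using calculation c(2) e(1) by simp
    ultimately show ?thesis
      using openin_chart_preimage[OF ch open_ball] c(2) e(1)
      by (intro exI[of _ "{s \<in> fst c. snd c s \<in> ball (snd c r) e}"]) auto
  qed
  \<comment> \<open>Under a locally constant function all preimages are open. \<open>P\<close> is
    used as equality with f p and as its negation.\<close>
  have op: "openin X {s \<in> topspace X. P (f s)}" for P
    unfolding openin_subopen[of X "{s \<in> topspace X. P (f s)}"]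
  proof
    fix r assume r: "r \<in> {s \<in> topspace X. P (f s)}"
    then obtain W where W: "openin X W" "r \<in> W" "\<forall>s\<in>W. f s = f r" using loc[of r] by blast
    have "s \<in> topspace X \<and> P (f s)" if "s \<in> W" for s
      using r that bspec[OF W(3) that] subsetD[OF openin_subset[OF W(1)] that] by simp
    then show "\<exists>T. openin X T \<and> r \<in> T \<and> T \<subseteq> {s \<in> topspace X. P (f s)}"
      using W(1,2) by blast
  qed
  have "topspace X - {s \<in> topspace X. f s = f p} = {s \<in> topspace X. f s \<noteq> f p}" by auto
  then have "closedin X {s \<in> topspace X. f s = f p}" using op[of "\<lambda>t. t \<noteq> f p"] by (simp add: closedin_def)
  moreover have "openin X {s \<in> topspace X. f s = f p}" using op[of "\<lambda>t. t = f p"] .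
  ultimately have "{s \<in> topspace X. f s = f p} = {} \<or> {s \<in> topspace X. f s = f p} = topspace X"
    using connected_space_clopen_in[THEN iffD1, OF connected] by blast
  moreover have "p \<in> {s \<in> topspace X. f s = f p}" using pq(1) by simp
  ultimately have "q \<in> {s \<in> topspace X. f s = f p}" using pq(2) by (metis emptyE)
  then show ?thesis by simp
qed

end

section \<open>Homothety homogeneous manifolds\<close>

locale homothety_homogeneous_manifold = pr_manifold X A g
  for X :: "'a topology" and A :: "('a, 'n::finite) chart set" and g +
  fixes P\<^sub>0 :: 'a
  assumes not_homogeneous: "\<not> homogeneous X A g"
    and hh: "homothety_homogeneous X A g"
    and curvature_nonzero: "p \<in> topspace X \<Longrightarrow> curvature_norm_sq A g p \<noteq> 0"
    and base_point: "P\<^sub>0 \<in> topspace X"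
begin

definition \<mu> :: "'a \<Rightarrow> real" where
  "\<mu> p = curvature_norm_sq A g P\<^sub>0 / curvature_norm_sq A g p"

lemma nonempty: "topspace X \<noteq> {}"
  using base_point by blast

lemma \<mu>_nonzero: "p \<in> topspace X \<Longrightarrow> \<mu> p \<noteq> 0"
  using curvature_nonzero base_point by (simp add: \<mu>_def)

lemma smooth_\<mu>: "smooth_fun A \<mu>"
  unfolding smooth_fun_def
proof
  fix c assume c: "c \<in> A"
  note ch = chart[OF c]
  interpret c: local_metric "snd c ` fst c" "g c" by (rule local_metric_chart[OF c])
  have eq: "curvature_norm_sq A g (chart_inv c x) = local_curvature_norm_sq (g c) x" if "x \<in> snd c ` fst c" for x
    using curvature_norm_sq_chart[OF c chart_inv_mem[OF that]] by (simp add: chart_eq_inv[OF that])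
  have "smooth_on (snd c ` fst c) (\<lambda>x. curvature_norm_sq A g P\<^sub>0 / local_curvature_norm_sq (g c) x)"
  proof (intro smooth_on_divide c.open_dom smooth_on_const c.smooth_on_local_curvature_norm_sq)
    show "local_curvature_norm_sq (g c) x \<noteq> 0" if "x \<in> snd c ` fst c" for x
      unfolding eq[OF that, symmetric]
      by (intro curvature_nonzero in_topspace[OF c] chart_inv_mem[OF that])
  qed
  then show "smooth_on (snd c ` fst c) (\<mu> \<circ> chart_inv c)"
    using smooth_on_cong[OF c.open_dom, of "\<mu> \<circ> chart_inv c"] eq by (simp add: \<mu>_def)
qed

lemma \<mu>_homothety:
  assumes "homothety X A g f" "p \<in> topspace X"
  shows "\<mu> (f p) = homothety_factor A g f ^ 4 * \<mu> p"
  by (simp add: \<mu>_def homothety_curvature_norm_sq[OF assms])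

text \<open>One point suffices: \<mu> p = \<lambda>^4 \<mu> p with \<mu> p nonzero and \<lambda>
  positive leaves only \<lambda> = 1.\<close>

lemma homothety_isometry:
  assumes "homothety X A g f" "p \<in> topspace X" "\<mu> (f p) = \<mu> p"
  shows "isometry X A g f"
proof -
  have "homothety_factor A g f ^ 4 = 1 ^ 4"
    using \<mu>_homothety[OF assms(1,2)] assms(3) \<mu>_nonzero[OF assms(2)] by simp
  then have "homothety_factor A g f = 1"
    using homothetyD(2)[OF assms(1) nonempty] by (subst (asm) power_eq_iff_eq_base) auto
  then show ?thesis
    using homothetyD(3)[OF assms(1) nonempty] assms(1)
    by (simp add: isometry_def homothety_def scale_metric_1)
qed

lemma isometry_homothety: "isometry X A g f \<Longrightarrow> homothety X A g f"
  unfolding isometry_def homothety_def by (metis one_neq_zero power_one scale_metric_1)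

lemma \<mu>_isometry:
  assumes "isometry X A g f" "p \<in> topspace X"
  shows "\<mu> (f p) = \<mu> p"
proof -
  have f: "smooth_map X A f" "pulls_back_to A f g (scale_metric (1\<^sup>2) g)"
    using assms(1) by (simp_all add: isometry_def diffeomorphism_def scale_metric_1)
  have "homothety_factor A g f = 1"
    using smooth_map_topspace[OF f(1)] f(2) nonempty by (intro homothety_factor_eqI) auto
  then show ?thesis using \<mu>_homothety[OF isometry_homothety[OF assms(1)] assms(2)] by simp
qed

lemma not_constant: "\<exists>p\<in>topspace X. \<exists>q\<in>topspace X. \<mu> p \<noteq> \<mu> q"
proof (rule ccontr)
  assume "\<not> ?thesis"
  then have const: "\<mu> p = \<mu> q" if "p \<in> topspace X" "q \<in> topspace X" for p q using that by blast
  have "\<exists>f. isometry X A g f \<and> f p = q" if p: "p \<in> topspace X" and q: "q \<in> topspace X" for p q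
  proof -
    obtain f where f: "homothety X A g f" "f p = q"
      using hh p q unfolding homothety_homogeneous_def by blast
    have "\<mu> (f p) = \<mu> p" using const[OF q p] f(2) by simp
    then show ?thesis using homothety_isometry[OF f(1) p] f(2) by blast
  qed
  then show False using not_homogeneous unfolding homogeneous_def by blast
qed

text \<open>A homothety taking \<open>q\<close> to \<open>p\<close> multiplies \<open>\<mu>\<close> by a constant, so it would carry a critical point
  \<open>p\<close> to every other point \<open>q\<close>.\<close>

lemma \<mu>_critical_everywhere:
  assumes c: "c \<in> A" "p \<in> fst c" and crit: "coord_differential c \<mu> p = (\<lambda>v. 0)"
    and d: "d \<in> A" "q \<in> fst d"
  shows "coord_differential d \<mu> q = (\<lambda>v. 0)"
proof -
  obtain f where f: "homothety X A g f" "f q = p"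
    using hh in_topspace[OF c] in_topspace[OF d] unfolding homothety_homogeneous_def by blast
  note F = homothetyD[OF f(1) nonempty]
  let ?k = "homothety_factor A g f ^ 4" and ?D = "coord_dom d c f"
  have k: "?k \<noteq> 0" using F(2) by simp
  have q: "snd d q \<in> ?D" using c d f(2) by (auto simp: coord_dom_def)
  \<comment> \<open>Near q, \<mu> is a constant multiple of \<mu> composed with f. By the chain rule
    its differential at q factors through the vanishing differential at p.\<close>
  have eq: "(\<mu> \<circ> chart_inv d) x = inverse ?k *\<^sub>R (\<mu> \<circ> chart_inv c) (coord_rep d c f x)" if x: "x \<in> ?D" for x
  proof -
    obtain r where r: "r \<in> fst d" "f r \<in> fst c" "x = snd d r" using x by (auto simp: coord_dom_def)
    then show ?thesis
      using k \<mu>_homothety[OF f(1) in_topspace[OF d(1) r(1)]]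
      by (simp add: coord_rep_eq[OF chart[OF d(1)]] chart_inv_eq[OF chart[OF c(1)]] chart_inv_eq[OF chart[OF d(1)]])
  qed
  have img: "coord_rep d c f (snd d q) = snd c p"
    using f(2) coord_rep_eq[OF chart[OF d(1)] d(2)] by simp
  have s: "smooth_on (snd c ` fst c) (\<mu> \<circ> chart_inv c)" using smooth_\<mu> c(1) by (simp add: smooth_fun_def)
  have m: "smooth_on (snd c ` fst c) (\<lambda>y. inverse ?k *\<^sub>R (\<mu> \<circ> chart_inv c) y)"
    by (rule smooth_on_bounded_linear[OF bounded_linear_scaleR_right chart_onD(3)[OF chart[OF c(1)]] s])
  have "dir_deriv v (\<mu> \<circ> chart_inv d) (snd d q) = 0" for v
  proof -
    have "dir_deriv v (\<mu> \<circ> chart_inv d) (snd d q) =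
        dir_deriv v (\<lambda>x. inverse ?k *\<^sub>R (\<mu> \<circ> chart_inv c) (coord_rep d c f x)) (snd d q)"
      by (rule dir_deriv_cong[OF smooth_mapD(1)[OF F(1) d(1) c(1)] q eq])
    also have "\<dots> = dir_deriv (dir_deriv v (coord_rep d c f) (snd d q))
        (\<lambda>y. inverse ?k *\<^sub>R (\<mu> \<circ> chart_inv c) y) (snd c p)"
      using dir_deriv_compose[OF smooth_mapD(2)[OF F(1) d(1) c(1)] m q, of v] c(2)
      unfolding img by blast
    also have "\<dots> = 0"
      using fun_cong[OF crit] c(2)
      by (subst dir_deriv_bounded_linear[OF bounded_linear_scaleR_right s]) (simp_all add: coord_differential_dir_deriv)
    finally show ?thesis .
  qed
  then show ?thesis by (simp add: coord_differential_dir_deriv)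
qed

lemma \<mu>_regular:
  assumes "c \<in> A" "p \<in> fst c"
  shows "coord_differential c \<mu> p \<noteq> (\<lambda>v. 0)"
  using not_constant smooth_fun_constant[OF smooth_\<mu> \<mu>_critical_everywhere[OF assms]] by blast

lemma \<mu>_flow_box:
  assumes "p \<in> topspace X"
  obtains d i a b where "d \<in> A" "p \<in> fst d" "snd d ` fst d = box a b"
    "\<And>q. q \<in> fst d \<Longrightarrow> snd d q $ i = \<mu> q - \<mu> p"
proof -
  obtain c where "c \<in> A" "p \<in> fst c" using chart_around[OF assms] by blast
  then show thesis using flow_box[OF smooth_\<mu> _ _ \<mu>_regular] that by metis
qed

section \<open>The level sets of \<mu> and the foliation by them\<close>

definition level :: "real \<Rightarrow> 'a set" where
  "level t = {p \<in> topspace X. \<mu> p = t}"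

text \<open>With \<mu> - s as a coordinate, every level set is a coordinate slice, not only the one
  at the value s. The case t = s serves the submanifold condition, general t the foliation
  condition.\<close>

lemma level_slice:
  assumes "d \<in> A" and "\<And>q. q \<in> fst d \<Longrightarrow> snd d q $ i = \<mu> q - s"
  shows "snd d ` (fst d \<inter> level t) = {x \<in> snd d ` fst d. x $ i = t - s}"
  using assms(2) in_topspace[OF assms(1)] by (auto simp: level_def)

lemma embedded_hypersurface_level: "embedded_hypersurface X A (level t)"
  unfolding embedded_hypersurface_def embedded_submanifold_def
proof (intro conjI ballI)
  show "level t \<subseteq> topspace X" by (auto simp: level_def)
  fix p assume p: "p \<in> level t"
  then obtain d i and a b :: "real ^ 'n" where d: "d \<in> A" "p \<in> fst d"
    "\<And>q. q \<in> fst d \<Longrightarrow> snd d q $ i = \<mu> q - \<mu> p"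
    using \<mu>_flow_box[of p] by (metis (mono_tags, lifting) level_def mem_Collect_eq)
  \<comment> \<open>The chart is based at p, where \<mu> equals t, so the slice is the zero set of
    the coordinate i and all others stay free.\<close>
  have "snd d ` (fst d \<inter> level t) = {x \<in> snd d ` fst d. \<forall>j. j \<notin> UNIV - {i} \<longrightarrow> x $ j = 0}"
    using level_slice[OF d(1,3), of t] p by (simp add: level_def)
  moreover have "card (UNIV - {i} :: 'n set) = CARD('n) - 1" by simp
  ultimately show "\<exists>c\<in>A. p \<in> fst c \<and> (\<exists>K::'n set. card K = CARD('n) - 1 \<and>
      snd c ` (fst c \<inter> level t) = {x \<in> snd c ` fst c. \<forall>i. i \<notin> K \<longrightarrow> x $ i = 0})"
    using d(1,2) by blast
qed

lemma isometry_level: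
  assumes "isometry X A g f"
  shows "f ` level t = level t"
proof -
  have f: "f ` topspace X = topspace X"
    using assms by (simp add: isometry_def diffeomorphism_def bij_betw_def)
  show ?thesis
  proof
    show "f ` level t \<subseteq> level t"
      using f \<mu>_isometry[OF assms] by (auto simp: level_def)
    show "level t \<subseteq> f ` level t"
    proof
      fix q assume q: "q \<in> level t"
      then obtain p where "p \<in> topspace X" "q = f p" using f by (auto simp: level_def)
      then show "q \<in> f ` level t" using q \<mu>_isometry[OF assms] by (auto simp: level_def)
    qed
  qed
qed

lemma isometry_transitive_level:
  assumes "p \<in> level t" "q \<in> level t"
  shows "\<exists>f. isometry X A g f \<and> f p = q"
proof -
  have pq: "p \<in> topspace X" "q \<in> topspace X" "\<mu> q = \<mu> p" using assms by (auto simp: level_def)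
  obtain f where f: "homothety X A g f" "f p = q"
    using hh pq(1,2) unfolding homothety_homogeneous_def by blast
  have "\<mu> (f p) = \<mu> p" using pq(3) f(2) by simp
  then show ?thesis using homothety_isometry[OF f(1) pq(1)] f(2) by blast
qed

lemma foliated_by_levels:
  "foliated_by_hypersurfaces X A {level t |t. level t \<noteq> {}}" (is "foliated_by_hypersurfaces X A ?F")
  unfolding foliated_by_hypersurfaces_def
proof (intro conjI ballI)
  show "H \<noteq> {}" "embedded_hypersurface X A H" if "H \<in> ?F" for H
    using that embedded_hypersurface_level by auto
  show "disjoint ?F" by (auto simp: disjoint_def level_def)
  show "\<Union>?F = topspace X" by (auto simp: level_def)
  fix p assume p: "p \<in> topspace X"
  obtain d i a b where d: "d \<in> A" "p \<in> fst d" "snd d ` fst d = box a b"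
    "\<And>q. q \<in> fst d \<Longrightarrow> snd d q $ i = \<mu> q - \<mu> p"
    using \<mu>_flow_box[OF p] by metis
  have "\<exists>T. countable T \<and> snd d ` (fst d \<inter> H) = {x \<in> snd d ` fst d. x $ i \<in> T}" if H: "H \<in> ?F" for H
  proof -
    obtain t where "H = level t" using H by blast
    then show ?thesis
      \<comment> \<open>One value is enough, since the coordinate determines \<mu>: a level meets
        the box in at most one plaque. If it misses the box, that value is not attained.\<close>
      using level_slice[OF d(1,4), of t] by (intro exI[of _ "{t - \<mu> p}"]) simp
  qed
  then show "\<exists>c\<in>A. p \<in> fst c \<and> (\<exists>a b. snd c ` fst c = box a b) \<and> (\<exists>i. \<forall>H\<in>?F. \<exists>T. countable T \<and>
      snd c ` (fst c \<inter> H) = {x \<in> snd c ` fst c. x $ i \<in> T})"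
    using d(1-3) by blast
qed

lemma cohomogeneity_one: "cohomogeneity_one X A g"
  unfolding cohomogeneity_one_def
  using foliated_by_levels isometry_level isometry_transitive_level
  by (intro exI[of _ "{level t |t. level t \<noteq> {}}"]) blast

end

text \<open>The clause relating the factor to \<mu> has exponent 4, because \<mu> varies inversely
  to |R|^2, which scales by \<lambda>^-4. At values that \<mu> does not take, the level set is empty
  and the clauses about it hold vacuously.\<close>

theorem theorem1p7:
  fixes X :: "'a topology"
    and A :: "('a, 'n::finite) chart set"
    and g :: "('a, 'n) tensor2"
    and P\<^sub>0 :: 'a
    and \<mu> :: "'a \<Rightarrow> real"
    and M_level :: "real \<Rightarrow> 'a set"
  assumes "pseudo_riemannian_manifold X A g"
    and "CARD('n) \<ge> 3"
    and "\<not> homogeneous X A g"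
    and "homothety_homogeneous X A g"
    and "\<forall>P\<in>topspace X. curvature_norm_sq A g P \<noteq> 0"
    and "P\<^sub>0 \<in> topspace X"
    and "\<mu> = (\<lambda>P. curvature_norm_sq A g P\<^sub>0 / curvature_norm_sq A g P)"
    and "M_level = (\<lambda>c. {P \<in> topspace X. \<mu> P = c})"
  shows "smooth_fun A \<mu>
    \<and> (\<forall>\<Phi>\<^sub>1 \<Phi>\<^sub>2. homothety X A g \<Phi>\<^sub>1 \<and> homothety X A g \<Phi>\<^sub>2 \<longrightarrow>
         (homothety_factor A g (\<Phi>\<^sub>1 \<circ> \<Phi>\<^sub>2))\<^sup>2 =
           (homothety_factor A g \<Phi>\<^sub>1)\<^sup>2 * (homothety_factor A g \<Phi>\<^sub>2)\<^sup>2)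
    \<and> (\<forall>\<Phi>. homothety X A g \<Phi> \<longrightarrow>
         (\<forall>P\<in>topspace X. (homothety_factor A g \<Phi>) ^ 4 = \<mu> (\<Phi> P) / \<mu> P))
    \<and> (\<forall>P\<in>topspace X. \<forall>c\<in>A. P \<in> fst c \<longrightarrow> coord_differential c \<mu> P \<noteq> (\<lambda>v. 0))
    \<and> (\<forall>c. embedded_hypersurface X A (M_level c))
    \<and> (\<forall>c. \<forall>P\<^sub>1\<in>M_level c. \<forall>P\<^sub>2\<in>M_level c.
         \<exists>\<Phi>. isometry X A g \<Phi> \<and> \<Phi> ` M_level c = M_level c \<and> \<Phi> P\<^sub>1 = P\<^sub>2)
    \<and> cohomogeneity_one X A g"
proof -
  interpret M: homothety_homogeneous_manifold X A g P\<^sub>0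
    using assms(1,3-6) by unfold_locales auto
  have \<mu>: "\<mu> = M.\<mu>" by (simp add: assms(7) M.\<mu>_def fun_eq_iff)
  have level: "M_level = M.level" by (simp add: assms(8) \<mu> M.level_def fun_eq_iff)
  show ?thesis
    unfolding \<mu> level
  proof (intro conjI allI impI ballI)
    fix \<Phi>\<^sub>1 \<Phi>\<^sub>2 assume "homothety X A g \<Phi>\<^sub>1 \<and> homothety X A g \<Phi>\<^sub>2"
    then show "(homothety_factor A g (\<Phi>\<^sub>1 \<circ> \<Phi>\<^sub>2))\<^sup>2 = (homothety_factor A g \<Phi>\<^sub>1)\<^sup>2 * (homothety_factor A g \<Phi>\<^sub>2)\<^sup>2"
      using M.homothety_factor_compose M.nonempty by (simp add: power_mult_distrib)
  next
    fix \<Phi> P assume "homothety X A g \<Phi>" "P \<in> topspace X"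
    then show "homothety_factor A g \<Phi> ^ 4 = M.\<mu> (\<Phi> P) / M.\<mu> P"
      using M.\<mu>_homothety M.\<mu>_nonzero by simp
  next
    fix c P\<^sub>1 P\<^sub>2 assume "P\<^sub>1 \<in> M.level c" "P\<^sub>2 \<in> M.level c"
    then show "\<exists>\<Phi>. isometry X A g \<Phi> \<and> \<Phi> ` M.level c = M.level c \<and> \<Phi> P\<^sub>1 = P\<^sub>2"
      using M.isometry_transitive_level M.isometry_level by blast
  qed (use M.smooth_\<mu> M.\<mu>_regular M.embedded_hypersurface_level M.cohomogeneity_one in auto)
qed

end
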